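(* Let $G$ be an $n$-vertex planar graph (with no restriction on its maximum degree) and $\lambda>0$. The mixing time of the Glauber dynamics for sampling from the hardcore model on $G$ with fugacity $\lambda$ is $(1+\lambda)^{O(\sqrt{n})}$.
   Context: The hardcore model on $G$ with fugacity $\lambda$ is the distribution $\mu$ on independent sets $I$ of $G$ with $\mu(I)\propto\lambda^{|I|}$. The Glauber dynamics picks a uniformly random vertex $v$ each step and resamples its occupation $\sigma_v\in\{0,1\}$ from its conditional distribution under $\mu$ given the rest; its mixing time is the smallest $t$ such that from every initial independent set the distribution after $t$ steps is within total variation distance $1/4$ of $\mu$. *)

theory Defs
  imports "Graph_Theory.Pair_Digraph" "HOL-Complex_Analysis.Complex_Analysis"
    "HOL-Probability.Probability"
begin

text \<open>
  A finite simple graph is a \<open>pair_graph\<close>: a finite, loop-free digraph without parallel arcs whose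
  arc relation is symmetric.  Each undirected edge \<open>{u, v}\<close> thus occurs as the two arcs
  \<open>(u, v)\<close> and \<open>(v, u)\<close>; the following set contains it once.
\<close>

definition edges :: "'a pair_pre_digraph \<Rightarrow> 'a set set" where
  "edges G = {{u, v} |u v. (u, v) \<in> parcs G}"

text \<open>
  An embedding in the plane (identified with \<open>complex\<close>) places the vertices at distinct points and
  draws every edge as a simple arc joining the positions of its two ends.  A drawn edge passes
  through no other vertex, and two different edges meet at most in the position of a common end.
\<close>

definition plane_embedding ::
    "'a pair_pre_digraph \<Rightarrow> ('a \<Rightarrow> complex) \<Rightarrow> ('a set \<Rightarrow> real \<Rightarrow> complex) \<Rightarrow> bool" where
  "plane_embedding G p \<gamma> \<longleftrightarrow>
     inj_on p (pverts G) \<and>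
     (\<forall>e\<in>edges G. arc (\<gamma> e) \<and> {pathstart (\<gamma> e), pathfinish (\<gamma> e)} = p ` e \<and>
                  path_image (\<gamma> e) \<inter> p ` pverts G = p ` e) \<and>
     (\<forall>e\<in>edges G. \<forall>f\<in>edges G. e \<noteq> f \<longrightarrow>
                  path_image (\<gamma> e) \<inter> path_image (\<gamma> f) = p ` (e \<inter> f))"

definition planar :: "'a pair_pre_digraph \<Rightarrow> bool" where
  "planar G \<longleftrightarrow> (\<exists>p \<gamma>. plane_embedding G p \<gamma>)"

definition independent_sets :: "'a pair_pre_digraph \<Rightarrow> 'a set set" where
  "independent_sets G = {I. I \<subseteq> pverts G \<and> (\<forall>u\<in>I. \<forall>v\<in>I. (u, v) \<notin> parcs G)}"

definition partition_function :: "'a pair_pre_digraph \<Rightarrow> real \<Rightarrow> real" where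
  "partition_function G lam = (\<Sum>I\<in>independent_sets G. lam ^ card I)"

text \<open>
  \<open>embed_pmf\<close> is only meaningful for a nonnegative function of total mass 1; the lemmas
  \<open>pmf_hardcore\<close> and \<open>set_pmf_hardcore\<close> below confirm that this is the case here.
\<close>

definition hardcore :: "'a pair_pre_digraph \<Rightarrow> real \<Rightarrow> 'a set pmf" where
  "hardcore G lam = embed_pmf (\<lambda>I. if I \<in> independent_sets G
                                   then lam ^ card I / partition_function G lam else 0)"

text \<open>
  One step from \<open>I\<close>: conditioning on the occupations of all vertices other than \<open>v\<close> is conditioning
  on the event that the random set agrees with \<open>I\<close> off \<open>v\<close>.  For an independent set \<open>I\<close> this event
  has positive probability, as \<open>cond_pmf\<close> requires (lemma \<open>hardcore_cond_ok\<close>).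
\<close>

definition glauber_step :: "'a pair_pre_digraph \<Rightarrow> real \<Rightarrow> 'a set \<Rightarrow> 'a set pmf" where
  "glauber_step G lam I =
     bind_pmf (pmf_of_set (pverts G)) (\<lambda>v. cond_pmf (hardcore G lam) {J. J - {v} = I - {v}})"

primrec glauber :: "'a pair_pre_digraph \<Rightarrow> real \<Rightarrow> 'a set \<Rightarrow> nat \<Rightarrow> 'a set pmf" where
  "glauber G lam I 0 = return_pmf I"
| "glauber G lam I (Suc t) = bind_pmf (glauber G lam I t) (glauber_step G lam)"

definition tv_dist :: "'a pmf \<Rightarrow> 'a pmf \<Rightarrow> real" where
  "tv_dist p q = (SUP A. \<bar>measure_pmf.prob p A - measure_pmf.prob q A\<bar>)"

text \<open>The value is \<open>\<infinity>\<close> if no \<open>t\<close> is large enough.\<close>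

definition mixing_time :: "'a pair_pre_digraph \<Rightarrow> real \<Rightarrow> enat" where
  "mixing_time G lam =
     (INF t \<in> {t. \<forall>I\<in>independent_sets G. tv_dist (glauber G lam I t) (hardcore G lam) \<le> 1 / 4}. enat t)"

lemma finite_independent_sets:
  assumes "pair_graph G"
  shows "finite (independent_sets G)"
proof -
  interpret pair_graph G by fact
  have "independent_sets G \<subseteq> Pow (pverts G)"
    by (auto simp: independent_sets_def)
  then show ?thesis
    using pair_finite_verts finite_subset by blast
qed

lemma partition_function_pos:
  assumes "pair_graph G" "lam > 0"
  shows "partition_function G lam > 0"
proof -
  have "{} \<in> independent_sets G"
    by (simp add: independent_sets_def)
  then show ?thesis
    unfolding partition_function_def
    using finite_independent_sets[OF assms(1)] assms(2) by (intro sum_pos) auto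
qed

lemma pmf_hardcore:
  assumes "pair_graph G" "lam > 0"
  shows "pmf (hardcore G lam) I =
    (if I \<in> independent_sets G then lam ^ card I / partition_function G lam else 0)"
  unfolding hardcore_def
proof (rule pmf_embed_pmf)
  note Z = partition_function_pos[OF assms] and fin = finite_independent_sets[OF assms(1)]
  let ?f = "\<lambda>I. if I \<in> independent_sets G then lam ^ card I / partition_function G lam else 0"
  show nonneg: "0 \<le> ?f J" for J
    using Z assms(2) by simp
  have "(\<integral>\<^sup>+ J. ennreal (?f J) \<partial>count_space UNIV) = (\<Sum>J\<in>independent_sets G. ennreal (?f J))"
    by (rule nn_integral_count_space'[OF fin]) auto
  also have "\<dots> = ennreal (\<Sum>J\<in>independent_sets G. ?f J)"
    using nonneg by (intro sum_ennreal)
  also have "(\<Sum>J\<in>independent_sets G. ?f J) = 1"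
    using Z by (simp add: partition_function_def flip: sum_divide_distrib)
  finally show "(\<integral>\<^sup>+ J. ennreal (?f J) \<partial>count_space UNIV) = 1"
    by simp
qed

lemma set_pmf_hardcore:
  assumes "pair_graph G" "lam > 0"
  shows "set_pmf (hardcore G lam) = independent_sets G"
  using partition_function_pos[OF assms] assms(2)
  by (auto simp: set_pmf_eq pmf_hardcore[OF assms])

lemma hardcore_cond_ok:
  assumes "pair_graph G" "lam > 0" "I \<in> independent_sets G"
  shows "set_pmf (hardcore G lam) \<inter> {J. J - {v} = I - {v}} \<noteq> {}"
  using assms by (auto simp: set_pmf_hardcore)

end

theory Submission
  imports Defs "HOL-Real_Asymp.Real_Asymp"
begin

text \<open>
  Winding numbers show that no drawing of \<open>K\<^sub>5\<close> in the plane keeps vertex-disjoint edges disjoint, so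
  a planar graph has no \<open>K\<^sub>5\<close> minor, and the argument of Alon, Seymour and Thomas gives it and its
  induced subgraphs balanced separators of size \<open>O(\<surd>n)\<close>.  Recursively, the vertices can be deleted
  and re-added one at a time, each vertex after all its neighbours have been deleted, such that at
  any time only \<open>O(\<surd>n)\<close> vertices are deleted but not yet re-added.

  Deleting according to \<open>I\<close> and re-adding according to \<open>J\<close> is a canonical path from \<open>I\<close> to \<open>J\<close> of congestion
  \<open>(1 + \<lambda>)\<^bsup>O(\<surd>n)\<^esup>\<close> up to polynomial factors, which bounds the relaxation time.  The logarithm of the
  minimal weight only contributes polynomial factors in \<open>n\<close> and \<open>1 + \<lambda>\<close>, which \<open>(1 + \<lambda>\<^sub>0)\<^bsup>\<surd>n\<^esup>\<close> absorbs.
\<close>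

section \<open>Connected sets and clique minors\<close>

text \<open>Planarity is given by a drawing, whereas the separator argument forbids a minor.
  Contracting edges inside a drawing is avoided by letting a path drawn within two branch sets stand
  for an edge of K5. Paths sharing a branch set may meet in any way, so the contradiction has to
  come from pairs of edges without a common end; a parity count provides it. Separators must leave
  components with at most half of the vertices, so that the widths in the recursion add up like a
  geometric series of ratio 1/sqrt 2. Degrees do not enter the congestion, because a pair of
  independent sets is encoded at the cost of its two traces on a small set only. Excluding K5 gives
  separators of at most 15 sqrt n vertices, the recursion multiplies this by 7/2, and the two traces
  double it to 105 sqrt n. One more sqrt n absorbs the polynomial factors, from an n on that depends
  on the lower bound for the fugacity.\<close>

definition connected_in :: "('a \<times> 'a) set \<Rightarrow> 'a set \<Rightarrow> bool" where
  "connected_in E S \<longleftrightarrow> S \<noteq> {} \<and> (\<forall>u\<in>S. \<forall>v\<in>S. (u, v) \<in> (Restr E S)\<^sup>*)"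

definition component :: "('a \<times> 'a) set \<Rightarrow> 'a set \<Rightarrow> 'a \<Rightarrow> 'a set" where
  "component E S u = (Restr E S)\<^sup>* `` {u}"

definition minor_model :: "('a \<times> 'a) set \<Rightarrow> 'a set \<Rightarrow> 'a set set \<Rightarrow> bool" where
  "minor_model E V \<C> \<longleftrightarrow> finite \<C> \<and> (\<forall>c\<in>\<C>. c \<subseteq> V \<and> connected_in E c) \<and>
     (\<forall>c\<in>\<C>. \<forall>d\<in>\<C>. c \<noteq> d \<longrightarrow> c \<inter> d = {} \<and> (\<exists>x\<in>c. \<exists>y\<in>d. (x, y) \<in> E))"

definition clique_minor :: "('a \<times> 'a) set \<Rightarrow> 'a set \<Rightarrow> nat \<Rightarrow> bool" where
  "clique_minor E V h \<longleftrightarrow> (\<exists>\<C>. card \<C> = h \<and> minor_model E V \<C>)"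

lemma minor_model_mono: "minor_model E W \<C> \<Longrightarrow> W \<subseteq> V \<Longrightarrow> minor_model E V \<C>"
  unfolding minor_model_def by (metis subset_trans)

lemma minor_model_subset:
  assumes "minor_model E V \<C>" "\<D> \<subseteq> \<C>"
  shows "minor_model E V \<D>"
proof -
  have sub: "\<And>c. c \<in> \<D> \<Longrightarrow> c \<in> \<C>" using assms(2) by blast
  have "finite \<D>" using assms finite_subset unfolding minor_model_def by metis
  then show ?thesis using assms(1) sub by (simp add: minor_model_def)
qed

lemma clique_minor_mono: "clique_minor E W h \<Longrightarrow> W \<subseteq> V \<Longrightarrow> clique_minor E V h"
  unfolding clique_minor_def using minor_model_mono by metis

lemma Restr_rtrancl_mem: "(u, v) \<in> (Restr E S)\<^sup>* \<Longrightarrow> u \<in> S \<Longrightarrow> v \<in> S"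
  by (induction rule: rtrancl_induct) auto

lemma Restr_rtrancl_mono: "(u, v) \<in> (Restr E S)\<^sup>* \<Longrightarrow> S \<subseteq> T \<Longrightarrow> (u, v) \<in> (Restr E T)\<^sup>*"
  by (erule rev_subsetD[OF _ rtrancl_mono]) auto

lemma Restr_rtrancl_sym: "sym E \<Longrightarrow> (u, v) \<in> (Restr E S)\<^sup>* \<Longrightarrow> (v, u) \<in> (Restr E S)\<^sup>*"
  by (rule symD[OF sym_rtrancl]) (auto simp: sym_def)

lemma connected_inI_root:
  assumes "sym E" "c \<in> S" "\<And>x. x \<in> S \<Longrightarrow> (c, x) \<in> (Restr E S)\<^sup>*"
  shows "connected_in E S"
  unfolding connected_in_def
proof (intro conjI ballI)
  fix u v assume "u \<in> S" "v \<in> S"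
  then have "(u, c) \<in> (Restr E S)\<^sup>*" "(c, v) \<in> (Restr E S)\<^sup>*"
    using assms(3) Restr_rtrancl_sym[OF assms(1)] by blast+
  then show "(u, v) \<in> (Restr E S)\<^sup>*" by (rule rtrancl_trans)
qed (use assms(2) in blast)

lemma connected_in_subset_closed:
  assumes "connected_in E W" "W \<subseteq> S" "W \<inter> U \<noteq> {}"
    and closed: "\<And>q z. q \<in> U \<Longrightarrow> z \<in> S \<Longrightarrow> (q, z) \<in> E \<Longrightarrow> z \<in> U"
  shows "W \<subseteq> U"
proof
  fix v assume "v \<in> W"
  obtain u where u: "u \<in> W" "u \<in> U" using assms(3) by blast
  have "(u, v) \<in> (Restr E W)\<^sup>*" using assms(1) u \<open>v \<in> W\<close> by (auto simp: connected_in_def)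
  then show "v \<in> U"
    by (induction rule: rtrancl_induct) (use u closed assms(2) in auto)
qed

lemma connected_in_insert:
  assumes "sym E" "connected_in E T" "v \<in> T" "(v, u) \<in> E"
  shows "connected_in E (insert u T)"
proof -
  let ?R = "(Restr E (insert u T))\<^sup>*"
  have to: "(v, x) \<in> ?R" if "x \<in> insert u T" for x
  proof (cases "x \<in> T")
    case True
    then have "(v, x) \<in> (Restr E T)\<^sup>*" using assms by (auto simp: connected_in_def)
    then show ?thesis by (rule Restr_rtrancl_mono) auto
  next
    case False
    then show ?thesis using that assms by auto
  qed
  then show ?thesis
    using assms(3) by (intro connected_inI_root[OF assms(1), of v]) auto
qed

lemma component_subset: "u \<in> S \<Longrightarrow> component E S u \<subseteq> S"
  by (auto simp: component_def intro: Restr_rtrancl_mem)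

lemma component_self: "u \<in> component E S u"
  by (auto simp: component_def)

lemma component_closed:
  "u \<in> S \<Longrightarrow> q \<in> component E S u \<Longrightarrow> z \<in> S \<Longrightarrow> (q, z) \<in> E \<Longrightarrow> z \<in> component E S u"
proof -
  assume "u \<in> S" "q \<in> component E S u" "z \<in> S" "(q, z) \<in> E"
  moreover then have "q \<in> S" using component_subset by fast
  ultimately show ?thesis unfolding component_def by (fastforce intro: rtrancl_into_rtrancl)
qed

lemma connected_in_Union_base:
  assumes "sym E" "C \<noteq> {}" and C: "\<And>u v. u \<in> C \<Longrightarrow> v \<in> C \<Longrightarrow> (u, v) \<in> (Restr E C)\<^sup>*"
    and "C \<subseteq> S"
  shows "connected_in E ((Restr E S)\<^sup>* `` C)"
proof -
  let ?D = "(Restr E S)\<^sup>* `` C"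
  obtain c where c: "c \<in> C" using assms by blast
  have CD: "C \<subseteq> ?D" by auto
  have to: "(c, x) \<in> (Restr E ?D)\<^sup>*" if x: "x \<in> ?D" for x
  proof -
    obtain d where d: "d \<in> C" "(d, x) \<in> (Restr E S)\<^sup>*" using x by auto
    from d(2) have "(c, x) \<in> (Restr E ?D)\<^sup>*"
    proof (induction rule: rtrancl_induct)
      case base
      show ?case by (rule Restr_rtrancl_mono[OF C[OF c d(1)] CD])
    next
      case (step y z)
      have "(d, z) \<in> (Restr E S)\<^sup>*" using step by (meson rtrancl_into_rtrancl)
      then have "y \<in> ?D" "z \<in> ?D" using d step by auto
      then show ?case using step by (auto intro: rtrancl_into_rtrancl)
    qed
    then show ?thesis .
  qed
  then show ?thesis
    using c CD by (intro connected_inI_root[OF assms(1), of c]) auto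
qed

lemma connected_in_component:
  assumes "sym E" "u \<in> S"
  shows "connected_in E (component E S u)"
  unfolding component_def using assms by (intro connected_in_Union_base) auto

section \<open>Small connected sets against small cuts\<close>

text \<open>Breadth-first layers from \<open>Q\<close> are disjoint, so one of the first
  \<open>r\<close> has at most \<open>card S / r\<close> elements. No walk jumps over a layer, and
  \<open>T\<close> lies beyond these layers. The relation may be directed.\<close>

lemma bfs_layer_cut:
  assumes fin: "finite S" and R: "R \<subseteq> S \<times> S" and Q: "Q \<subseteq> S" and r: "r > 0"
    and far: "\<And>j q t. j < r \<Longrightarrow> q \<in> Q \<Longrightarrow> t \<in> T \<Longrightarrow> (q, t) \<notin> R ^^ j"
  obtains Z where "Z \<subseteq> S" "r * card Z \<le> card S"
    "\<And>q t. q \<in> Q - Z \<Longrightarrow> t \<in> T \<Longrightarrow> (q, t) \<notin> (Restr R (S - Z))\<^sup>*"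
proof -
  define B where "B j = (R ^^ j) `` Q" for j
  define L where "L j = B j - (\<Union>i<j. B i)" for j
  have BS: "B j \<subseteq> S" for j
    using R Q by (cases j) (auto simp: B_def)
  have LS: "L j \<subseteq> S" for j using BS by (auto simp: L_def)
  have disj: "L i \<inter> L j = {}" if "i \<noteq> j" for i j
    using that by (cases i j rule: linorder_cases) (auto simp: L_def)
  obtain j where j: "j < r" "r * card (L j) \<le> card S"
  proof (rule ccontr)
    assume "\<not> thesis"
    then have gt: "card S < r * card (L j)" if "j < r" for j
      using that \<open>\<And>j. j < r \<Longrightarrow> r * card (L j) \<le> card S \<Longrightarrow> thesis\<close> not_less by blast
    have "(\<Sum>j<r. card S) < (\<Sum>j<r. r * card (L j))"
      using gt r by (intro sum_strict_mono) auto
    also have "\<dots> = r * card (\<Union>j<r. L j)"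
      using disj finite_subset[OF LS fin]
      by (subst card_UN_disjoint) (auto simp: sum_distrib_left)
    also have "\<dots> \<le> r * card S"
      using LS fin by (intro mult_left_mono card_mono) auto
    finally show False by simp
  qed
  show ?thesis
  proof (rule that[of "L j"])
    show "L j \<subseteq> S" by (rule LS)
    show "r * card (L j) \<le> card S" by (rule j)
    fix q t assume q: "q \<in> Q - L j" and t: "t \<in> T"
    show "(q, t) \<notin> (Restr R (S - L j))\<^sup>*"
    proof
      assume "(q, t) \<in> (Restr R (S - L j))\<^sup>*"
      \<comment> \<open>A step from \<open>B i\<close> with \<open>i < j\<close> that avoids layer
        \<open>j\<close> ends in an earlier set again, since \<open>B j - L j\<close> is covered by
        the \<open>B i\<close> with \<open>i < j\<close>.\<close>
      then have "\<exists>i<j. t \<in> B i"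
      proof (induction rule: rtrancl_induct)
        case base
        have "q \<in> B 0" using q by (auto simp: B_def)
        moreover have "j \<noteq> 0" using q \<open>q \<in> B 0\<close> by (cases "j = 0") (auto simp: L_def)
        ultimately show ?case by blast
      next
        case (step y z)
        then obtain i where i: "i < j" "y \<in> B i" by blast
        have z: "z \<in> B (Suc i)" using i step by (auto simp: B_def)
        show ?case
        proof (cases "Suc i = j")
          case True
          then show ?thesis using z step by (auto simp: L_def)
        next
          case False
          then show ?thesis using z i by (meson Suc_lessI)
        qed
      qed
      then obtain i where "i < j" "t \<in> B i" by blast
      then show False using far[of i] t j by (auto simp: B_def)
    qed
  qed
qed

text \<open>Walks in \<open>k\<close> stacked copies of the graph, where passing from copy \<open>i\<close> to copy
  \<open>i + 1\<close> is allowed in \<open>A (i + 1)\<close>, visit the sets \<open>A 0, \<dots>, A (k - 1)\<close> in this order.\<close>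

lemma small_connected_or_cut:
  assumes fin: "finite U" and sym: "sym E" and r: "r > 0" and k: "k > 0"
    and A: "\<And>i. i < k \<Longrightarrow> A i \<subseteq> U"
  obtains T where "T \<subseteq> U" "connected_in E T" "card T \<le> r" "\<And>i. i < k \<Longrightarrow> T \<inter> A i \<noteq> {}"
  | Z where "Z \<subseteq> U" "r * card Z \<le> k * card U"
      "\<And>W. W \<subseteq> U - Z \<Longrightarrow> connected_in E W \<Longrightarrow> \<exists>i<k. W \<inter> A i = {}"
proof -
  define S where "S = U \<times> {..<k}"
  define R where "R = {((v, i), (u, i)) |u v i. (v, u) \<in> E \<and> u \<in> U \<and> v \<in> U \<and> i < k} \<union>
    {((v, i), (v, Suc i)) |v i. v \<in> A (Suc i) \<and> Suc i < k}"
  define Q where "Q = A 0 \<times> {0::nat}"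
  \<comment> \<open>The whole last copy is the target: being there means that
    \<open>A (k - 1)\<close> has already been visited.\<close>
  define T where "T = U \<times> {k - 1}"
  have finS: "finite S" and RS: "R \<subseteq> S \<times> S" and QS: "Q \<subseteq> S" and cS: "card S = k * card U"
    using fin A k by (auto simp: S_def R_def Q_def)
  show ?thesis
  proof (cases "\<exists>j<r. \<exists>q\<in>Q. \<exists>t\<in>T. (q, t) \<in> R ^^ j")
    case True
    then obtain j q t where j: "j < r" "q \<in> Q" "t \<in> T" "(q, t) \<in> R ^^ j" by blast
    \<comment> \<open>A walk of \<open>j\<close> steps projects to at most \<open>j + 1\<close>
      vertices; \<open>j < r\<close> then gives the bound \<open>r\<close>.\<close>
    have inv: "\<exists>P. P \<subseteq> U \<and> connected_in E P \<and> fst t \<in> P \<and> card P \<le> Suc j \<and> (\<forall>m\<le>snd t. P \<inter> A m \<noteq> {})"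
      if "(q, t) \<in> R ^^ j" for t j
      using that
    proof (induction j arbitrary: t)
      case 0
      then show ?case using \<open>q \<in> Q\<close> A[of 0] k
        by (intro exI[of _ "{fst q}"]) (auto simp: Q_def connected_in_def)
    next
      case (Suc j)
      then obtain y where y: "(q, y) \<in> R ^^ j" "(y, t) \<in> R" by auto
      obtain P where P: "P \<subseteq> U" "connected_in E P" "fst y \<in> P" "card P \<le> Suc j"
        "\<forall>m\<le>snd y. P \<inter> A m \<noteq> {}" using Suc.IH[OF y(1)] by blast
      have finP: "finite P" using P fin finite_subset by blast
      from y(2) consider (E) v u i where "y = (v, i)" "t = (u, i)" "(v, u) \<in> E" "u \<in> U"
        | (A) v i where "y = (v, i)" "t = (v, Suc i)" "v \<in> A (Suc i)"
        by (auto simp: R_def)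
      then show ?case
      proof cases
        case E
        then show ?thesis using P finP connected_in_insert[OF sym P(2), of v u]
          by (intro exI[of _ "insert u P"]) (auto simp: card_insert_if)
      next
        case A
        then show ?thesis using P
          by (intro exI[of _ P]) (auto simp: le_Suc_eq)
      qed
    qed
    obtain P where P: "P \<subseteq> U" "connected_in E P" "card P \<le> Suc j" "\<forall>m\<le>snd t. P \<inter> A m \<noteq> {}"
      using inv[OF j(4)] by blast
    show ?thesis
      by (rule that(1)[of P]) (use P j k in \<open>auto simp: T_def\<close>)
  next
    case False
    then have far: "\<And>j q t. j < r \<Longrightarrow> q \<in> Q \<Longrightarrow> t \<in> T \<Longrightarrow> (q, t) \<notin> R ^^ j" by blast
    obtain Z where Z: "Z \<subseteq> S" "r * card Z \<le> card S"
      "\<And>q t. q \<in> Q - Z \<Longrightarrow> t \<in> T \<Longrightarrow> (q, t) \<notin> (Restr R (S - Z))\<^sup>*"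
      using bfs_layer_cut[OF finS RS QS r far] by blast
    have finZ: "finite Z" using Z finS finite_subset by blast
    show ?thesis
    \<comment> \<open>The cut of the stack is projected to the graph. A set \<open>W\<close>
      avoiding the projection has all its \<open>k\<close> copies intact, and if it met every
      \<open>A i\<close>, it would carry a walk from \<open>Q\<close> to the last copy.\<close>
    proof (rule that(2)[of "fst ` Z"])
      show "fst ` Z \<subseteq> U" using Z by (auto simp: S_def)
      show "r * card (fst ` Z) \<le> k * card U"
        using Z(2) card_image_le[OF finZ, of fst] cS by (metis le_trans mult_le_mono2)
      fix W assume W: "W \<subseteq> U - fst ` Z" "connected_in E W"
      show "\<exists>i<k. W \<inter> A i = {}"
      proof (rule ccontr)
        assume "\<not> ?thesis"
        then have meet: "\<And>i. i < k \<Longrightarrow> W \<inter> A i \<noteq> {}" by blast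
        then obtain a where a: "a \<in> W" "a \<in> A 0" using k by blast
        have mem: "(w, i) \<in> S - Z" if "w \<in> W" "i < k" for w i
          using that W by (force simp: S_def)
        have walk: "((u, i), (w, i)) \<in> (Restr R (S - Z))\<^sup>*" if "u \<in> W" "w \<in> W" "i < k" for u w i
        proof -
          have "(u, w) \<in> (Restr E W)\<^sup>*" using W that by (auto simp: connected_in_def)
          then show ?thesis
          proof (induction rule: rtrancl_induct)
            case (step y z)
            then have "((y, i), (z, i)) \<in> Restr R (S - Z)"
              using mem that W by (auto simp: R_def)
            then show ?case using step by (meson rtrancl_into_rtrancl)
          qed auto
        qed
        have "((a, 0), (w, i)) \<in> (Restr R (S - Z))\<^sup>*" if "w \<in> W" "i < k" for w i
          using that
        proof (induction i arbitrary: w)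
          case 0
          then show ?case using walk a k by blast
        next
          case (Suc i)
          obtain b where b: "b \<in> W" "b \<in> A (Suc i)" using meet Suc by blast
          have "((a, 0), (b, i)) \<in> (Restr R (S - Z))\<^sup>*" using Suc b by auto
          moreover have "((b, i), (b, Suc i)) \<in> Restr R (S - Z)"
            using b Suc mem by (auto simp: R_def)
          ultimately show ?case using walk[OF b(1) Suc.prems] by (meson rtrancl_trans r_into_rtrancl)
        qed
        from this[OF a(1), of "k - 1"] have "((a, 0), (a, k - 1)) \<in> (Restr R (S - Z))\<^sup>*"
          using k by auto
        moreover have "(a, 0) \<in> Q - Z" "(a, k - 1) \<in> T"
          using a mem[OF a(1) k] W by (auto simp: Q_def T_def)
        ultimately show False using Z(3) by blast
      qed
    qed
  qed
qed

section \<open>Separators in graphs without a clique minor\<close>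

definition closed_in :: "('a \<times> 'a) set \<Rightarrow> 'a set \<Rightarrow> 'a set \<Rightarrow> bool" where
  "closed_in E S U \<longleftrightarrow> U \<subseteq> S \<and> (\<forall>q\<in>U. \<forall>z\<in>S. (q, z) \<in> E \<longrightarrow> z \<in> U)"

text \<open>Two sets with more than half of the vertices intersect, so \<open>U\<close> is
  determined by \<open>X\<close> and shrinks when \<open>X\<close> grows. The map from
  \<open>X\<close> to \<open>U\<close> is the haven of a graph without a balanced separator.\<close>

definition big_component :: "('a \<times> 'a) set \<Rightarrow> 'a set \<Rightarrow> 'a set \<Rightarrow> 'a set \<Rightarrow> bool" where
  "big_component E V X U \<longleftrightarrow> connected_in E U \<and> closed_in E (V - X) U \<and> card V < 2 * card U"

lemma closed_in_subset: "closed_in E S U \<Longrightarrow> U \<subseteq> S"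
  by (simp add: closed_in_def)

lemma connected_in_subset_closed_in:
  "connected_in E W \<Longrightarrow> W \<subseteq> S \<Longrightarrow> W \<inter> U \<noteq> {} \<Longrightarrow> closed_in E S U \<Longrightarrow> W \<subseteq> U"
  using connected_in_subset_closed[of E W S U] unfolding closed_in_def by blast

lemma closed_in_component: "u \<in> S \<Longrightarrow> closed_in E S (component E S u)"
  using component_subset component_closed unfolding closed_in_def by metis

lemma big_sets_meet:
  assumes "finite V" "U \<subseteq> V" "W \<subseteq> V" "card V < 2 * card U" "card V < 2 * card W"
  shows "U \<inter> W \<noteq> {}"
proof
  assume "U \<inter> W = {}"
  then have "card U + card W = card (U \<union> W)"
    using assms finite_subset by (metis card_Un_disjoint)
  also have "\<dots> \<le> card V" using assms by (intro card_mono) auto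
  finally show False using assms by linarith
qed

lemma big_component_mono:
  assumes fin: "finite V" and U: "big_component E V X U" and Y: "big_component E V (X \<union> Z) Y"
  shows "Y \<subseteq> U"
proof (rule connected_in_subset_closed_in)
  show "connected_in E Y" "closed_in E (V - X) U" "Y \<subseteq> V - X"
    using U Y by (auto simp: big_component_def closed_in_def)
  show "Y \<inter> U \<noteq> {}"
    using U Y by (intro big_sets_meet[OF fin]) (auto simp: big_component_def closed_in_def)
qed

lemma exists_big_component:
  assumes "finite V" "sym E" "W \<subseteq> V - X" "connected_in E W" "card V < 2 * card W"
  obtains U where "big_component E V X U"
proof -
  obtain w where w: "w \<in> W" using assms(4) by (auto simp: connected_in_def)
  let ?U = "component E (V - X) w"
  have wS: "w \<in> V - X" using w assms(3) by blast
  have cl: "closed_in E (V - X) ?U" by (rule closed_in_component[OF wS])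
  have "W \<subseteq> ?U"
    using w by (intro connected_in_subset_closed_in[OF assms(4,3) _ cl])
      (auto intro: component_self)
  moreover have "finite ?U" using cl assms(1) unfolding closed_in_def by (meson finite_Diff finite_subset)
  ultimately have "card W \<le> card ?U" by (intro card_mono)
  then have "card V < 2 * card ?U" using assms(5) by linarith
  then have "big_component E V X ?U"
    using cl connected_in_component[OF assms(2) wS] by (simp add: big_component_def)
  then show ?thesis by (rule that)
qed

text \<open>The invariant of the Alon--Seymour--Thomas argument: \<open>X\<close> is the part of the branch sets
  facing \<open>U\<close>, and it separates \<open>U\<close> from the rest of the graph.\<close>

definition covey :: "('a \<times> 'a) set \<Rightarrow> 'a set \<Rightarrow> nat \<Rightarrow> 'a set set \<Rightarrow> 'a set \<Rightarrow> 'a set \<Rightarrow> bool" where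
  "covey E V m \<C> X U \<longleftrightarrow> minor_model E V \<C> \<and> X \<subseteq> \<Union>\<C> \<and> (\<forall>c\<in>\<C>. card (X \<inter> c) \<le> m \<and> c \<inter> U = {}) \<and>
     big_component E V X U"

lemma covey_card:
  assumes "covey E V m \<C> X U"
  shows "card X \<le> card \<C> * m"
proof -
  have fin: "finite \<C>" and X: "X = (\<Union>c\<in>\<C>. X \<inter> c)" and le: "\<And>c. c \<in> \<C> \<Longrightarrow> card (X \<inter> c) \<le> m"
    using assms by (auto simp: covey_def minor_model_def)
  have "card X \<le> (\<Sum>c\<in>\<C>. card (X \<inter> c))" by (subst X) (rule card_UN_le[OF fin])
  also have "\<dots> \<le> (\<Sum>c\<in>\<C>. m)" by (rule sum_mono[OF le])
  finally show ?thesis by simp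
qed

text \<open>A branch set without neighbours in \<open>U\<close> is dropped. Otherwise
  \<open>small_connected_or_cut\<close> is applied inside \<open>U\<close> to the neighbourhoods
  \<open>N c\<close>: a small connected set meeting all of them becomes a new branch set; after a
  small cut \<open>Z\<close>, the big component misses some \<open>N c\<close>, and this
  \<open>c\<close> is extended into \<open>U\<close>. In each case the pair of \<open>card U\<close>
  and \<open>card \<C>\<close> decreases lexicographically.\<close>

lemma covey_step:
  assumes fin: "finite V" and sym: "sym E" and m: "m > 0" "(h - 1) * card V \<le> m\<^sup>2"
    and big: "\<And>X. X \<subseteq> V \<Longrightarrow> card X \<le> h * m \<Longrightarrow> \<exists>U. big_component E V X U"
    and cov: "covey E V m \<C> X U" and h: "card \<C> < h"
  shows "\<exists>\<C>' X' U'. covey E V m \<C>' X' U' \<and>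
    (card \<C>' = Suc (card \<C>) \<and> card U' < card U \<or> card \<C>' \<le> card \<C> \<and> card U' < card U \<or>
     card \<C>' < card \<C> \<and> U' = U)"
proof -
  have mm: "minor_model E V \<C>" and X: "X \<subseteq> \<Union>\<C>"
    and cm: "\<And>c. c \<in> \<C> \<Longrightarrow> card (X \<inter> c) \<le> m" and cU: "\<And>c. c \<in> \<C> \<Longrightarrow> c \<inter> U = {}"
    and U: "big_component E V X U"
    using cov by (auto simp: covey_def)
  have finC: "finite \<C>" and CV: "\<And>c. c \<in> \<C> \<Longrightarrow> c \<subseteq> V" and Cc: "\<And>c. c \<in> \<C> \<Longrightarrow> connected_in E c"
    and Cd: "\<And>c d. c \<in> \<C> \<Longrightarrow> d \<in> \<C> \<Longrightarrow> c \<noteq> d \<Longrightarrow> c \<inter> d = {}"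
    and Ca: "\<And>c d. c \<in> \<C> \<Longrightarrow> d \<in> \<C> \<Longrightarrow> c \<noteq> d \<Longrightarrow> \<exists>x\<in>c. \<exists>y\<in>d. (x, y) \<in> E"
    using mm unfolding minor_model_def by blast+
  have XV: "X \<subseteq> V" using X CV by blast
  have UV: "U \<subseteq> V" "X \<inter> U = {}" and Uc: "connected_in E U" and U0: "U \<noteq> {}" and finU: "finite U"
    and Ucl: "closed_in E (V - X) U" and Ubig: "card V < 2 * card U"
    using U fin by (auto simp: big_component_def closed_in_def connected_in_def intro: finite_subset)
  define N where "N c = {u \<in> U. \<exists>w\<in>c. (w, u) \<in> E}" for c
  show ?thesis
  proof (cases "\<exists>c\<in>\<C>. N c = {}")
    case True
    then obtain c where c: "c \<in> \<C>" "N c = {}" by blast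
    have "closed_in E (V - (X - c)) U"
      unfolding closed_in_def
    proof (intro conjI ballI impI)
      show "U \<subseteq> V - (X - c)" using UV by blast
      fix q z assume "q \<in> U" "z \<in> V - (X - c)" "(q, z) \<in> E"
      then show "z \<in> U" using c(2) Ucl symD[OF sym, of q z] by (auto simp: N_def closed_in_def)
    qed
    then have "big_component E V (X - c) U" using Uc Ubig by (simp add: big_component_def)
    moreover have "minor_model E V (\<C> - {c})" by (rule minor_model_subset[OF mm Diff_subset])
    moreover have "card ((X - c) \<inter> d) \<le> m" if "d \<in> \<C>" for d
    proof -
      have "card ((X - c) \<inter> d) \<le> card (X \<inter> d)"
        using XV fin by (intro card_mono) (auto intro: finite_subset)
      then show ?thesis using cm[OF that] by simp
    qed
    ultimately have "covey E V m (\<C> - {c}) (X - c) U"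
      using X cU unfolding covey_def by blast
    moreover have "card (\<C> - {c}) < card \<C>" using c finC by (meson card_Diff1_less)
    ultimately show ?thesis by blast
  next
    case False
    then have Nne: "\<And>c. c \<in> \<C> \<Longrightarrow> N c \<noteq> {}" by blast
    have "(\<exists>T. T \<subseteq> U \<and> connected_in E T \<and> card T \<le> m \<and> (\<forall>c\<in>\<C>. T \<inter> N c \<noteq> {})) \<or>
      (\<exists>Z. Z \<subseteq> U \<and> card Z \<le> m \<and> (\<forall>W. W \<subseteq> U - Z \<longrightarrow> connected_in E W \<longrightarrow> (\<exists>c\<in>\<C>. W \<inter> N c = {})))"
    proof (cases "\<C> = {}")
      case True
      obtain u where "u \<in> U" using U0 by blast
      then show ?thesis using True m
        by (intro disjI1 exI[of _ "{u}"]) (auto simp: connected_in_def)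
    next
      case False
      let ?k = "card \<C>"
      have k: "0 < ?k" using False finC by (simp add: card_gt_0_iff)
      obtain e where e: "bij_betw e {..<?k} \<C>"
        using ex_bij_betw_nat_finite[OF finC] by (auto simp: atLeast0LessThan)
      have img: "e ` {..<?k} = \<C>" using e by (rule bij_betw_imp_surj_on)
      have NU: "\<And>i. i < ?k \<Longrightarrow> N (e i) \<subseteq> U" by (auto simp: N_def)
      show ?thesis
      proof (rule small_connected_or_cut[where A = "\<lambda>i. N (e i)", OF finU sym m(1) k], goal_cases)
        case (1 i)
        then show ?case by (rule NU)
      next
        case (2 T)
        then have "\<forall>c\<in>e ` {..<?k}. T \<inter> N c \<noteq> {}" by blast
        then show ?thesis using 2 unfolding img by blast
      next
        case (3 Z)
        \<comment> \<open>At most \<open>h - 1\<close> neighbourhoods are to be visited; the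
          condition on \<open>m\<close> is what bounds the cut by \<open>m\<close>.\<close>
        have "m * card Z \<le> ?k * card U" by (rule 3)
        also have "\<dots> \<le> (h - 1) * card V" using h UV fin by (intro mult_mono card_mono) auto
        also have "\<dots> \<le> m * m" using m by (simp add: power2_eq_square)
        finally have "card Z \<le> m" using m by simp
        moreover have "\<exists>c\<in>\<C>. W \<inter> N c = {}" if W: "W \<subseteq> U - Z" "connected_in E W" for W
        proof -
          have "\<exists>c\<in>e ` {..<?k}. W \<inter> N c = {}" using 3(3)[OF W] by blast
          then show ?thesis unfolding img .
        qed
        ultimately show ?thesis using 3(1) by blast
      qed
    qed
    then consider (T) T where "T \<subseteq> U" "connected_in E T" "card T \<le> m" "\<And>c. c \<in> \<C> \<Longrightarrow> T \<inter> N c \<noteq> {}"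
      | (Z) Z where "Z \<subseteq> U" "card Z \<le> m"
          "\<And>W. W \<subseteq> U - Z \<Longrightarrow> connected_in E W \<Longrightarrow> \<exists>c\<in>\<C>. W \<inter> N c = {}"
      by blast
    then show ?thesis
    proof cases
      case T
      have T0: "T \<noteq> {}" using T by (auto simp: connected_in_def)
      \<comment> \<open>Fewer than \<open>h\<close> branch sets have at most \<open>m\<close>
        vertices each in \<open>X\<close>, so there is room for \<open>m\<close> more within
        \<open>h * m\<close>.\<close>
      have "card (X \<union> T) \<le> card X + card T" by (rule card_Un_le)
      also have "\<dots> \<le> Suc (card \<C>) * m" using covey_card[OF cov] T by simp
      also have "\<dots> \<le> h * m" using h by (intro mult_right_mono) auto
      finally obtain U' where U': "big_component E V (X \<union> T) U'"
        using big[of "X \<union> T"] XV T UV by blast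
      have sub: "U' \<subseteq> U - T"
        using big_component_mono[OF fin U U'] U' by (auto simp: big_component_def closed_in_def)
      have Td: "T \<inter> c = {}" if "c \<in> \<C>" for c using that cU T by blast
      have TnC: "T \<notin> \<C>" using Td T0 by blast
      have mm': "minor_model E V (insert T \<C>)"
        unfolding minor_model_def
      proof (intro conjI ballI impI)
        show "finite (insert T \<C>)" using finC by simp
        fix c assume c: "c \<in> insert T \<C>"
        show "c \<subseteq> V" "connected_in E c" using c CV Cc T UV by auto
        fix d assume d: "d \<in> insert T \<C>" "c \<noteq> d"
        show "c \<inter> d = {}" using c d Cd Td by blast
        have adj: "\<exists>x\<in>c. \<exists>y\<in>T. (x, y) \<in> E" if "c \<in> \<C>" for c
          using T(4)[OF that] by (auto simp: N_def)
        then have "\<exists>x\<in>T. \<exists>y\<in>c. (x, y) \<in> E" if "c \<in> \<C>" for c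
          using that symD[OF sym] by meson
        with adj show "\<exists>x\<in>c. \<exists>y\<in>d. (x, y) \<in> E" using c d Ca by blast
      qed
      have "card ((X \<union> T) \<inter> c) \<le> m" if "c \<in> insert T \<C>" for c
      proof (cases "c = T")
        case True
        have "(X \<union> T) \<inter> T = T" by blast
        then show ?thesis using True T by simp
      next
        case False
        then have "(X \<union> T) \<inter> c = X \<inter> c" using that Td by blast
        then show ?thesis using cm that False by auto
      qed
      then have "covey E V m (insert T \<C>) (X \<union> T) U'"
        unfolding covey_def
      proof (intro conjI ballI)
        show "a \<inter> U' = {}" if "a \<in> insert T \<C>" for a using that sub cU by blast
      qed (use mm' X U' in auto)
      moreover have "card U' < card U"
        using sub T T0 finU by (intro psubset_card_mono) auto
      moreover have "card (insert T \<C>) = Suc (card \<C>)" using TnC finC by simp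
      ultimately show ?thesis by blast
    next
      case Z
      have "card (X \<union> Z) \<le> card X + card Z" by (rule card_Un_le)
      also have "\<dots> \<le> Suc (card \<C>) * m" using covey_card[OF cov] Z by simp
      also have "\<dots> \<le> h * m" using h by (intro mult_right_mono) auto
      finally have cXZ: "card (X \<union> Z) \<le> h * m" .
      then obtain Y where Y: "big_component E V (X \<union> Z) Y"
        using big[of "X \<union> Z"] XV Z UV by blast
      have YU: "Y \<subseteq> U - Z"
        using big_component_mono[OF fin U Y] Y by (auto simp: big_component_def closed_in_def)
      obtain c where c: "c \<in> \<C>" "Y \<inter> N c = {}" using Z(3)[OF YU] Y by (auto simp: big_component_def)
      \<comment> \<open>The branch set swallows whatever it reaches in \<open>U\<close> without
        entering \<open>Y\<close>, in particular all its neighbours in \<open>U\<close>. Its old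
        part of \<open>X\<close> then no longer borders the rest of \<open>U\<close>, and
        \<open>Z \<inter> D\<close> replaces it.\<close>
      define D where "D = (Restr E (c \<union> (U - Y)))\<^sup>* `` c"
      have cD: "c \<subseteq> D" by (auto simp: D_def)
      have Dsub: "D \<subseteq> c \<union> (U - Y)"
        unfolding D_def using Restr_rtrancl_mem[of _ _ E "c \<union> (U - Y)"] by blast
      have Dstep: "z \<in> D" if "q \<in> D" "z \<in> c \<union> (U - Y)" "(q, z) \<in> E" for q z
      proof -
        have "q \<in> c \<union> (U - Y)" using that Dsub by blast
        then have "(q, z) \<in> Restr E (c \<union> (U - Y))" using that by blast
        then show ?thesis using that(1) unfolding D_def by (meson Image_iff rtrancl_into_rtrancl)
      qed
      have Dc: "connected_in E D"
        unfolding D_def using Cc[OF c(1)] sym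
        by (intro connected_in_Union_base) (auto simp: connected_in_def)
      have ND: "N c \<subseteq> D"
      proof
        fix u assume "u \<in> N c"
        then obtain w where "w \<in> c" "(w, u) \<in> E" "u \<in> U - Y" using c(2) by (auto simp: N_def)
        then show "u \<in> D" using Dstep cD by blast
      qed
      define X' where "X' = (X - c) \<union> (Z \<inter> D)"
      have DV: "D \<subseteq> V" using Dsub CV c UV by blast
      have Dd: "D \<inter> d = {}" if "d \<in> \<C>" "d \<noteq> c" for d
        using Dsub Cd[OF c(1) that(1)] that cU[OF that(1)] by blast
      have "card X' \<le> card (X \<union> Z)"
        unfolding X'_def using finite_subset[OF XV fin] finite_subset[OF Z(1) finU]
        by (intro card_mono) auto
      also note cXZ
      finally obtain U' where U': "big_component E V X' U'"
        using big[of X'] XV Z UV unfolding X'_def by blast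
      \<comment> \<open>An edge from \<open>U - D\<close> that leaves \<open>U\<close> would end in
        \<open>X \<inter> c\<close>, but \<open>N c\<close> lies in \<open>D\<close>. An edge to a
        vertex of \<open>D\<close> outside \<open>Z\<close> would end in \<open>Y\<close> if it
        started there, and would otherwise put its start into \<open>D\<close>.\<close>
      have cl: "closed_in E (V - X') (U - D)"
        unfolding closed_in_def
      proof (intro conjI ballI impI)
        show "U - D \<subseteq> V - X'" using UV by (auto simp: X'_def)
        fix q z assume q: "q \<in> U - D" and z: "z \<in> V - X'" and qz: "(q, z) \<in> E"
        have zq: "(z, q) \<in> E" using qz symD[OF sym] by blast
        have zU: "z \<in> U"
        proof (rule ccontr)
          assume "z \<notin> U"
          then have "z \<in> X" using Ucl q z qz by (auto simp: closed_in_def)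
          then have "z \<in> c" using z by (auto simp: X'_def)
          then have "q \<in> N c" using q zq by (auto simp: N_def)
          then show False using ND q by blast
        qed
        moreover have "z \<notin> D"
        proof
          assume zD: "z \<in> D"
          then have "z \<notin> Z" using z by (auto simp: X'_def)
          have "z \<notin> Y" using zD zU Dsub cU[OF c(1)] by blast
          show False
          proof (cases "q \<in> Y")
            case True
            moreover have "z \<in> V - (X \<union> Z)" using zU UV \<open>z \<notin> Z\<close> by blast
            ultimately have "z \<in> Y" using Y qz unfolding big_component_def closed_in_def by blast
            then show False using \<open>z \<notin> Y\<close> by blast
          next
            case False
            then show False using Dstep[OF zD _ zq] q by blast
          qed
        qed
        ultimately show "z \<in> U - D" by blast
      qed
      have YD: "Y \<subseteq> U - D" using YU Dsub cU[OF c(1)] by blast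
      have sub: "U' \<subseteq> U - D"
      proof (rule connected_in_subset_closed_in[OF _ _ _ cl])
        show "connected_in E U'" "U' \<subseteq> V - X'" using U' by (auto simp: big_component_def closed_in_def)
        have "U' \<inter> Y \<noteq> {}"
          using U' Y by (intro big_sets_meet[OF fin]) (auto simp: big_component_def closed_in_def)
        then show "U' \<inter> (U - D) \<noteq> {}" using YD by blast
      qed
      let ?\<C> = "insert D (\<C> - {c})"
      have mm': "minor_model E V ?\<C>"
        unfolding minor_model_def
      proof (intro conjI ballI impI)
        show "finite ?\<C>" using finC by simp
        fix a assume a: "a \<in> ?\<C>"
        show "a \<subseteq> V" "connected_in E a" using a CV Cc DV Dc by auto
        fix b assume b: "b \<in> ?\<C>" "a \<noteq> b"
        show "a \<inter> b = {}" using a b Cd Dd by blast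
        have adj: "\<exists>x\<in>D. \<exists>y\<in>d. (x, y) \<in> E" if "d \<in> \<C> - {c}" for d
          using Ca[OF c(1), of d] that cD by blast
        have "\<exists>x\<in>d. \<exists>y\<in>D. (x, y) \<in> E" if "d \<in> \<C> - {c}" for d
          using Ca[OF _ c(1), of d] that cD by blast
        with adj show "\<exists>x\<in>a. \<exists>y\<in>b. (x, y) \<in> E" using a b Ca by blast
      qed
      have cm': "card (X' \<inter> a) \<le> m" if "a \<in> ?\<C>" for a
      proof (cases "a = D")
        case True
        have "X' \<inter> D \<subseteq> Z"
          using Dsub UV by (auto simp: X'_def)
        then have "card (X' \<inter> D) \<le> card Z" 
          using finite_subset[OF Z(1) finU] by (intro card_mono)
        then show ?thesis using True Z by simp
      next
        case False
        then have a: "a \<in> \<C>" "a \<noteq> c" using that by auto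
        have "X' \<inter> a \<subseteq> X \<inter> a" using Dd[OF a] by (auto simp: X'_def)
        then have "card (X' \<inter> a) \<le> card (X \<inter> a)"
          using XV fin by (intro card_mono) (auto intro: finite_subset)
        then show ?thesis using cm[OF a(1)] by simp
      qed
      have "covey E V m ?\<C> X' U'"
        unfolding covey_def
      proof (intro conjI ballI)
        show "X' \<subseteq> \<Union>?\<C>" using X by (auto simp: X'_def)
        show "a \<inter> U' = {}" if "a \<in> ?\<C>" for a using that sub cU by auto
      qed (use mm' cm' U' in auto)
      moreover have "card U' < card U"
      proof (intro psubset_card_mono finU psubsetI)
        show "U' \<subseteq> U" using sub by blast
        \<comment> \<open>Strictness comes from \<open>N c\<close>, which is nonempty after the
          first case distinction and has been absorbed.\<close>
        obtain u where "u \<in> N c" using Nne[OF c(1)] by blast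
        then have "u \<in> U" "u \<in> D" using ND by (auto simp: N_def)
        then show "U' \<noteq> U" using sub by blast
      qed
      moreover have "card ?\<C> \<le> card \<C>"
        using c finC by (metis card_Suc_Diff1 card_insert_le_m1 diff_Suc_1 finite_Diff zero_less_Suc order_refl)
      ultimately show ?thesis by blast
    qed
  qed
qed

text \<open>Without a separator, every \<open>X\<close> of size at most \<open>h * m\<close> leaves
  a component with more than half of the vertices. From the empty covey, \<open>covey_step\<close>
  could then be repeated until \<open>h\<close> branch sets form a clique minor, because its measure
  is well-founded.\<close>

theorem clique_minor_free_separator:
  assumes fin: "finite V" and sym: "sym E" and m: "m > 0" "(h - 1) * card V \<le> m\<^sup>2"
    and free: "\<not> clique_minor E V h" and h: "h > 0"
  shows "\<exists>X\<subseteq>V. card X \<le> h * m \<and> (\<forall>W\<subseteq>V - X. connected_in E W \<longrightarrow> 2 * card W \<le> card V)"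
proof (rule ccontr)
  assume neg: "\<not> ?thesis"
  have big: "\<exists>U. big_component E V X U" if X: "X \<subseteq> V" "card X \<le> h * m" for X
  proof -
    have "\<exists>W\<subseteq>V - X. connected_in E W \<and> card V < 2 * card W"
      using neg X by (meson not_le)
    then show ?thesis using exists_big_component[OF fin sym] by blast
  qed
  have no: "\<not> covey E V m \<C> X U" if "card \<C> < h" for \<C> X U
    using that
  proof (induction "(card U, card \<C>)" arbitrary: \<C> X U rule: wf_induct_rule[OF wf_lex_prod[OF wf_less_than wf_less_than]])
    case 1
    show ?case
    proof
      assume cov: "covey E V m \<C> X U"
      obtain \<C>' X' U' where new: "covey E V m \<C>' X' U'"
        "card \<C>' = Suc (card \<C>) \<and> card U' < card U \<or> card \<C>' \<le> card \<C> \<and> card U' < card U \<or>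
         card \<C>' < card \<C> \<and> U' = U"
        using covey_step[OF fin sym m big cov 1(2)] by blast
      have "card \<C>' \<noteq> h"
        using new(1) free by (auto simp: covey_def clique_minor_def)
      then have lt: "card \<C>' < h" using new(2) 1(2) by auto
      have "((card U', card \<C>'), (card U, card \<C>)) \<in> less_than <*lex*> less_than"
        using new(2) by auto
      from 1(1)[OF this lt] new(1) show False by blast
    qed
  qed
  obtain U where "big_component E V {} U" using big[of "{}"] by auto
  then have "covey E V m {} {} U" by (auto simp: covey_def minor_model_def)
  then show False using no[of "{}"] h by auto
qed

section \<open>Sweeps\<close>

text \<open>A state \<open>(D, A)\<close> of a sweep records the vertices \<open>D\<close> already deleted and the vertices \<open>A\<close>
  already re-added.\<close>

definition sweep_state :: "('a \<times> 'a) set \<Rightarrow> 'a set \<Rightarrow> real \<Rightarrow> 'a set \<Rightarrow> 'a set \<Rightarrow> bool" where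
  "sweep_state E V w D A \<longleftrightarrow> A \<subseteq> D \<and> D \<subseteq> V \<and> (\<forall>u\<in>A. \<forall>v\<in>V - D. (u, v) \<notin> E) \<and> real (card (D - A)) \<le> w"

text \<open>Both ends have to be admissible: the congestion of a deletion is measured at its start,
  that of a re-addition at its end.\<close>

definition sweep_step :: "('a \<times> 'a) set \<Rightarrow> 'a set \<Rightarrow> real \<Rightarrow> (('a set \<times> 'a set) \<times> ('a set \<times> 'a set)) set" where
  "sweep_step E V w = {((D, A), (D', A')). sweep_state E V w D A \<and> sweep_state E V w D' A' \<and>
     (\<exists>v. v \<notin> D \<and> D' = insert v D \<and> A' = A \<or> v \<in> D - A \<and> D' = D \<and> A' = insert v A)}"

text \<open>With \<open>X\<close> kept deleted and \<open>P\<close> already re-added, sweeping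
  \<open>Q\<close> alone is a legal continuation, because within \<open>W\<close> the neighbours of
  \<open>Q\<close> lie in \<open>Q\<close> and \<open>X\<close>. Only \<open>card X\<close> is added
  to the width.\<close>

lemma sweep_translate:
  assumes fin: "finite W" and sub: "X \<subseteq> W" "P \<subseteq> W - X" "Q \<subseteq> W - X" "P \<inter> Q = {}"
    and cl: "closed_in E (W - X) P" "closed_in E (W - X) Q"
    and w: "real (card X) + w' \<le> w"
    and sw: "(({}, {}), (Q, Q)) \<in> (sweep_step E Q w')\<^sup>*"
  shows "((X \<union> P, P), (X \<union> (P \<union> Q), P \<union> Q)) \<in> (sweep_step E W w)\<^sup>*"
proof -
  define f where "f = (\<lambda>(D, A). (X \<union> P \<union> D, P \<union> A))"
  have adm: "sweep_state E W w (X \<union> P \<union> D) (P \<union> A)" if "sweep_state E Q w' D A" for D A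
    unfolding sweep_state_def
  proof (intro conjI ballI)
    have DA: "A \<subseteq> D" "D \<subseteq> Q" "\<And>u v. u \<in> A \<Longrightarrow> v \<in> Q - D \<Longrightarrow> (u, v) \<notin> E" "real (card (D - A)) \<le> w'"
      using that by (auto simp: sweep_state_def)
    show "P \<union> A \<subseteq> X \<union> P \<union> D" "X \<union> P \<union> D \<subseteq> W" using DA sub by auto
    show "(u, v) \<notin> E" if "u \<in> P \<union> A" "v \<in> W - (X \<union> P \<union> D)" for u v
      using that cl DA unfolding closed_in_def by blast
    have "card (X \<union> P \<union> D - (P \<union> A)) \<le> card (X \<union> (D - A))"
    proof (rule card_mono)
      have "X \<union> (D - A) \<subseteq> W" using sub DA by blast
      then show "finite (X \<union> (D - A))" using fin finite_subset by blast
    qed (use DA in blast)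
    also have "\<dots> \<le> card X + card (D - A)" by (rule card_Un_le)
    finally show "real (card (X \<union> P \<union> D - (P \<union> A))) \<le> w" using DA w by linarith
  qed
  have step: "(f x, f y) \<in> sweep_step E W w" if "(x, y) \<in> sweep_step E Q w'" for x y
  proof -
    obtain D A D' A' where xy': "x = (D, A)" "y = (D', A')" by (metis surj_pair)
    then have xy: "x = (D, A)" "y = (D', A')" "sweep_state E Q w' D A" "sweep_state E Q w' D' A'"
      and "\<exists>v. v \<notin> D \<and> D' = insert v D \<and> A' = A \<or> v \<in> D - A \<and> D' = D \<and> A' = insert v A"
      using that by (auto simp: sweep_step_def)
    then obtain v where v: "v \<notin> D \<and> D' = insert v D \<and> A' = A \<or> v \<in> D - A \<and> D' = D \<and> A' = insert v A"
      by blast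
    have "v \<in> Q" using v xy by (auto simp: sweep_state_def)
    then have "v \<notin> X" "v \<notin> P" using sub by auto
    then show ?thesis
      using v adm[OF xy(3)] adm[OF xy(4)] unfolding sweep_step_def f_def xy by auto
  qed
  from sw have "(f ({}, {}), f (Q, Q)) \<in> (sweep_step E W w)\<^sup>*"
    by (induction rule: rtrancl_induct) (auto intro: step rtrancl_into_rtrancl)
  then show ?thesis by (simp add: f_def Un_assoc)
qed

text \<open>Each component is completely re-added before the next one is started, so the widths of
  different components do not add up. Allowing any union \<open>P\<close> of components makes the
  induction work.\<close>

lemma sweep_components:
  assumes fin: "finite W" and sym: "sym E" and X: "X \<subseteq> W" and w: "real (card X) + w' \<le> w" and "w' \<ge> 0"
    and comp: "\<And>Q. Q \<subseteq> W - X \<Longrightarrow> connected_in E Q \<Longrightarrow> (({}, {}), (Q, Q)) \<in> (sweep_step E Q w')\<^sup>*"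
    and P: "closed_in E (W - X) P"
  shows "((X, {}), (X \<union> P, P)) \<in> (sweep_step E W w)\<^sup>*"
proof -
  have "finite P" using P fin by (auto simp: closed_in_def intro: finite_subset)
  then show ?thesis using P
  proof (induction P rule: finite_psubset_induct)
    case (psubset P)
    show ?case
    proof (cases "P = {}")
      case False
      then obtain u where u: "u \<in> P" by blast
      then have uS: "u \<in> W - X" using psubset.prems by (auto simp: closed_in_def)
      define Q where "Q = component E (W - X) u"
      have Qc: "connected_in E Q" and Qcl: "closed_in E (W - X) Q"
        unfolding Q_def by (rule connected_in_component[OF sym uS], rule closed_in_component[OF uS])
      have uQ: "u \<in> Q" unfolding Q_def by (rule component_self)
      have QP: "Q \<subseteq> P"
        using uQ u Qcl by (intro connected_in_subset_closed_in[OF Qc _ _ psubset.prems]) (auto simp: closed_in_def)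
      have cl: "closed_in E (W - X) (P - Q)"
        unfolding closed_in_def
      proof (intro conjI ballI impI)
        show "P - Q \<subseteq> W - X" using psubset.prems by (auto simp: closed_in_def)
        fix q z assume qz: "q \<in> P - Q" "z \<in> W - X" "(q, z) \<in> E"
        then have "z \<in> P" using psubset.prems by (auto simp: closed_in_def)
        moreover have "z \<notin> Q"
        proof
          assume "z \<in> Q"
          moreover have "(z, q) \<in> E" using qz symD[OF sym] by blast
          moreover have "q \<in> W - X" using qz psubset.prems by (auto simp: closed_in_def)
          ultimately show False using qz Qcl unfolding closed_in_def by blast
        qed
        ultimately show "z \<in> P - Q" by blast
      qed
      have PW: "P - Q \<subseteq> W - X" "Q \<subseteq> W - X" using cl Qcl by (simp_all add: closed_in_subset)
      have eq: "(P - Q) \<union> Q = P" using QP by blast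
      have "((X, {}), (X \<union> (P - Q), P - Q)) \<in> (sweep_step E W w)\<^sup>*"
        using u uQ QP by (intro psubset.IH cl) auto
      also have "((X \<union> (P - Q), P - Q), (X \<union> ((P - Q) \<union> Q), (P - Q) \<union> Q)) \<in> (sweep_step E W w)\<^sup>*"
        by (rule sweep_translate[OF fin X PW _ cl Qcl w comp[OF PW(2) Qc]]) blast
      finally show ?thesis unfolding eq .
    qed simp
  qed
qed

lemma sweep_delete:
  assumes "finite X" "X \<subseteq> W" "real (card X) \<le> w"
  shows "(({}, {}), (X, {})) \<in> (sweep_step E W w)\<^sup>*"
proof -
  have "Y \<subseteq> X \<Longrightarrow> (({}, {}), (Y, {})) \<in> (sweep_step E W w)\<^sup>*" if "finite Y" for Y
    using that
  proof (induction Y rule: finite_induct)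
    case (insert v Y)
    have "card (insert v Y) \<le> card X" "card Y \<le> card X"
      using insert assms by (intro card_mono; auto)+
    then have "((Y, {}), (insert v Y, {})) \<in> sweep_step E W w"
      using insert assms unfolding sweep_step_def sweep_state_def by auto
    then show ?case using insert by (meson insert_subset rtrancl_into_rtrancl)
  qed simp
  then show ?thesis using assms by blast
qed

lemma sweep_add:
  assumes "finite X" "X \<subseteq> W" "real (card X) \<le> w"
  shows "((W, W - X), (W, W)) \<in> (sweep_step E W w)\<^sup>*"
proof -
  have "Y \<subseteq> X \<Longrightarrow> ((W, W - X), (W, W - X \<union> Y)) \<in> (sweep_step E W w)\<^sup>*" if "finite Y" for Y
    using that
  proof (induction Y rule: finite_induct)
    case (insert v Y)
    have "card (W - (W - X \<union> insert v Y)) \<le> card X" "card (W - (W - X \<union> Y)) \<le> card X"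
      using insert assms by (intro card_mono; auto)+
    then have "((W, W - X \<union> Y), (W, W - X \<union> insert v Y)) \<in> sweep_step E W w"
      using insert assms unfolding sweep_step_def sweep_state_def by auto
    then show ?case using insert by (meson insert_subset rtrancl_into_rtrancl)
  qed simp
  from this[of X] show ?thesis using assms by (simp add: Un_absorb2)
qed

text \<open>Width \<open>\<kappa> * s * sqrt n\<close> reproduces itself in the recursion if
  \<open>1 + \<kappa> / sqrt 2 \<le> \<kappa>\<close>. Bounding \<open>1 / sqrt 2\<close> by
  \<open>5 / 7\<close> gives \<open>\<kappa> = 7 / 2\<close>, of which \<open>5 / 2\<close> is left
  for the components.\<close>

lemma sweep_exists:
  assumes fin: "finite V" and sym: "sym E" and s: "s \<ge> 0"
    and sep: "\<And>W. W \<subseteq> V \<Longrightarrow> \<exists>X\<subseteq>W. real (card X) \<le> s * sqrt (card W) \<and>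
      (\<forall>Q\<subseteq>W - X. connected_in E Q \<longrightarrow> 2 * card Q \<le> card W)"
  shows "(({}, {}), (V, V)) \<in> (sweep_step E V (7 / 2 * s * sqrt (card V)))\<^sup>*"
proof -
  have mono: "p \<in> (sweep_step E Q w)\<^sup>* \<Longrightarrow> w \<le> w' \<Longrightarrow> p \<in> (sweep_step E Q w')\<^sup>*" for p Q w w'
    by (erule rev_subsetD[OF _ rtrancl_mono]) (auto simp: sweep_step_def sweep_state_def)
  have "W \<subseteq> V \<Longrightarrow> (({}, {}), (W, W)) \<in> (sweep_step E W (7 / 2 * s * sqrt (card W)))\<^sup>*" for W
  proof (induction "card W" arbitrary: W rule: less_induct)
    case less
    have finW: "finite W" using less.prems fin finite_subset by blast
    show ?case
    proof (cases "W = {}")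
      case False
      then have W0: "card W > 0" using finW by (simp add: card_gt_0_iff)
      obtain X where X: "X \<subseteq> W" "real (card X) \<le> s * sqrt (card W)"
        and half: "\<And>Q. Q \<subseteq> W - X \<Longrightarrow> connected_in E Q \<Longrightarrow> 2 * card Q \<le> card W"
        using sep[OF less.prems] by blast
      let ?w = "7 / 2 * s * sqrt (card W)" and ?w' = "5 / 2 * s * sqrt (card W)"
      have sum: "real (card X) + ?w' \<le> ?w" using X(2) by simp
      have w0: "0 \<le> ?w'" using s by simp
      have Xw: "real (card X) \<le> ?w" using sum w0 by linarith
      have finX: "finite X" using X finW finite_subset by blast
      have comp: "(({}, {}), (Q, Q)) \<in> (sweep_step E Q ?w')\<^sup>*" if Q: "Q \<subseteq> W - X" "connected_in E Q" for Q
      proof (rule mono)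
        show "(({}, {}), (Q, Q)) \<in> (sweep_step E Q (7 / 2 * s * sqrt (card Q)))\<^sup>*"
          using half[OF Q] Q W0 less.prems by (intro less.hyps) auto
        have "49 * real (card Q) \<le> 25 * real (card W)" using half[OF Q] by linarith
        then have "sqrt (49 * real (card Q)) \<le> sqrt (25 * real (card W))" by (rule real_sqrt_le_mono)
        then have "7 * sqrt (card Q) \<le> 5 * sqrt (card W)" by (simp add: real_sqrt_mult)
        then have "s * (7 * sqrt (card Q)) \<le> s * (5 * sqrt (card W))" using s by (rule mult_left_mono)
        then show "7 / 2 * s * sqrt (card Q) \<le> ?w'" by simp
      qed
      have "(({}, {}), (X, {})) \<in> (sweep_step E W ?w)\<^sup>*" by (rule sweep_delete[OF finX X(1) Xw])
      also have "((X, {}), (X \<union> (W - X), W - X)) \<in> (sweep_step E W ?w)\<^sup>*"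
        by (intro sweep_components[OF finW sym X(1) sum w0 comp]) (auto simp: closed_in_def)
      also have "X \<union> (W - X) = W" using X by blast
      also have "((W, W - X), (W, W)) \<in> (sweep_step E W ?w)\<^sup>*" by (rule sweep_add[OF finX X(1) Xw])
      finally show ?thesis .
    qed simp
  qed
  then show ?thesis by blast
qed

text \<open>Every step enlarges exactly one of the two sets by one vertex, so
  \<open>card D + card A\<close> counts the steps made.\<close>

lemma sweep_sequence:
  assumes fin: "finite V" and sw: "(({}, {}), (V, V)) \<in> (sweep_step E V w)\<^sup>*"
  obtains D A where "D 0 = {}" "A 0 = {}" "D (2 * card V) = V" "A (2 * card V) = V"
    "\<And>t. t < 2 * card V \<Longrightarrow> ((D t, A t), (D (Suc t), A (Suc t))) \<in> sweep_step E V w"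
proof -
  obtain m where "(({}, {}), (V, V)) \<in> sweep_step E V w ^^ m" using sw rtrancl_imp_relpow by blast
  then obtain f where f: "f 0 = ({}, {})" "f m = (V, V)" "\<And>t. t < m \<Longrightarrow> (f t, f (Suc t)) \<in> sweep_step E V w"
    unfolding relpow_fun_conv by blast
  have "card (fst (f t)) + card (snd (f t)) = t" if "t \<le> m" for t
    using that
  proof (induction t)
    case (Suc t)
    obtain D A D' A' where e: "f t = (D, A)" "f (Suc t) = (D', A')" by (metis surj_pair)
    have st: "((D, A), (D', A')) \<in> sweep_step E V w" using f(3)[of t] Suc.prems e by simp
    then have fDA: "finite D" "finite A" and AD: "A \<subseteq> D"
      using fin unfolding sweep_step_def sweep_state_def by (auto dest: finite_subset)
    have "\<exists>v. v \<notin> D \<and> D' = insert v D \<and> A' = A \<or> v \<in> D - A \<and> D' = D \<and> A' = insert v A"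
      using st by (simp add: sweep_step_def)
    then have "card D' + card A' = Suc (card D + card A)" using fDA by auto
    then show ?case using Suc e by simp
  qed (use f in simp)
  from this[of m] have "m = 2 * card V" using f by simp
  then show ?thesis using f by (intro that[of "\<lambda>t. fst (f t)" "\<lambda>t. snd (f t)"]) auto
qed

section \<open>Planar graphs have no K5 minor\<close>

text \<open>Two continuous logarithms of \<open>g - a\<close> differ by a continuous function with
  values in a discrete set, hence by a constant. So the winding number can be read off from any
  logarithm, in particular from one shared by a family of paths.\<close>

lemma continuous_log_increment:
  assumes "path g" "a \<notin> path_image g" and h: "continuous_on {0..1} h"
    and gh: "\<And>t. t \<in> {0..1} \<Longrightarrow> g t = a + exp (h t)"
  shows "h 1 - h 0 = 2 * of_real pi * \<i> * winding_number g a"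
proof -
  obtain q where q: "path q" "pathfinish q - pathstart q = 2 * of_real pi * \<i> * winding_number g a"
    "\<And>t. t \<in> {0..1} \<Longrightarrow> g t = a + exp (q t)"
    using winding_number_as_continuous_log[OF assms(1,2)] by blast
  have eq: "exp (h t - q t) = 1" if "t \<in> {0..1}" for t
    using gh[OF that] q(3)[OF that] by (simp add: exp_diff)
  have "(\<lambda>t. h t - q t) constant_on {0..1}"
  proof (rule continuous_discrete_range_constant)
    show "continuous_on {0..1} (\<lambda>t. h t - q t)"
      using h q(1) by (auto simp: path_def intro!: continuous_intros)
    fix t :: real assume t: "t \<in> {0..1}"
    show "\<exists>e>0. \<forall>u. u \<in> {0..1} \<and> h u - q u \<noteq> h t - q t \<longrightarrow> e \<le> norm ((h u - q u) - (h t - q t))"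
    proof (intro exI[of _ "1::real"] conjI allI impI)
      fix u assume u: "u \<in> {0..1} \<and> h u - q u \<noteq> h t - q t"
      have ex: "\<exists>m::int. h t - q t = of_int (2 * m) * pi * \<i>" if "t \<in> {0..1}" for t
        using eq[OF that] exp_eq[of "h t - q t" 0] by simp
      obtain m n :: int where mn: "h u - q u = of_int (2 * m) * pi * \<i>" "h t - q t = of_int (2 * n) * pi * \<i>"
        using ex[OF t] ex[of u] u by blast
      have "m \<noteq> n" using u mn by auto
      then have "1 \<le> \<bar>real_of_int (m - n)\<bar>" by linarith
      moreover have "(h u - q u) - (h t - q t) = of_real (2 * real_of_int (m - n) * pi) * \<i>"
        unfolding mn by (simp add: algebra_simps)
      then have "norm ((h u - q u) - (h t - q t)) = \<bar>real_of_int (m - n)\<bar> * (2 * pi)"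
        by (simp only: norm_mult norm_of_real norm_ii mult_1_right) (simp add: abs_mult del: of_int_diff)
      moreover have "1 * 1 \<le> \<bar>real_of_int (m - n)\<bar> * (2 * pi)"
        using calculation(1) pi_gt3 by (intro mult_mono) auto
      ultimately show "1 \<le> norm ((h u - q u) - (h t - q t))" by simp
    qed auto
  qed auto
  then have "h 1 - q 1 = h 0 - q 0" by (auto simp: constant_on_def)
  then have "h 1 - h 0 = q 1 - q 0" by (simp add: algebra_simps)
  then show ?thesis using q(2) by (simp add: pathfinish_def pathstart_def)
qed

text \<open>On the unit square \<open>g t - e s\<close> has no zero and thus a continuous logarithm
  \<open>L\<close>, whose total increment around the boundary vanishes. Two opposite sides give the
  winding numbers of \<open>g\<close> around the ends of \<open>e\<close>; the other two, after
  adding \<open>\<i> * pi\<close> to pass to \<open>e s - g t\<close>, give those of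
  \<open>e\<close> around the ends of \<open>g\<close>.\<close>

lemma winding_number_disjoint_paths:
  assumes e: "path e" and g: "path g" and disj: "path_image e \<inter> path_image g = {}"
  shows "winding_number g (pathstart e) + winding_number e (pathfinish g) =
    winding_number e (pathstart g) + winding_number g (pathfinish e)"
proof -
  let ?Q = "{0..1::real} \<times> {0..1::real}"
  have ne: "g t \<noteq> e s" if "s \<in> {0..1}" "t \<in> {0..1}" for s t
    using disj that unfolding path_image_def by (metis IntI empty_iff imageI)
  have "continuous_on ?Q (\<lambda>z. g (snd z))"
    by (rule continuous_on_compose2[of "{0..1}" g]) (use g in \<open>auto simp: path_def intro!: continuous_intros\<close>)
  moreover have "continuous_on ?Q (\<lambda>z. e (fst z))"
    by (rule continuous_on_compose2[of "{0..1}" e]) (use e in \<open>auto simp: path_def intro!: continuous_intros\<close>)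
  ultimately have "continuous_on ?Q (\<lambda>z. g (snd z) - e (fst z))" by (rule continuous_on_diff)
  moreover have "contractible ?Q" by (intro convex_imp_contractible convex_Times) auto
  ultimately obtain L where L: "continuous_on ?Q L" "\<And>z. z \<in> ?Q \<Longrightarrow> g (snd z) - e (fst z) = exp (L z)"
  proof (rule continuous_logarithm_on_contractible)
    fix z assume "z \<in> ?Q"
    then show "g (snd z) - e (fst z) \<noteq> 0" using ne[of "fst z" "snd z"] by auto
  qed blast
  have contL: "continuous_on {0..1} (\<lambda>u. L (f u))"
    if "continuous_on {0..1::real} f" "f ` {0..1} \<subseteq> ?Q" for f
    by (rule continuous_on_compose2[OF L(1) that])
  have gL: "g t = e s + exp (L (s, t))" if "s \<in> {0..1}" "t \<in> {0..1}" for s t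
    using L(2)[of "(s, t)"] that by (simp add: algebra_simps)
  have eL: "e s = g t + exp (L (s, t) + \<i> * pi)" if "s \<in> {0..1}" "t \<in> {0..1}" for s t
    using gL[OF that] by (simp add: exp_add)
  have G: "L (s, 1) - L (s, 0) = 2 * of_real pi * \<i> * winding_number g (e s)" if s: "s \<in> {0..1}" for s
  proof (rule continuous_log_increment[OF g])
    show "e s \<notin> path_image g" using ne s by (force simp: path_image_def)
    show "continuous_on {0..1} (\<lambda>t. L (s, t))"
      using s by (intro contL continuous_intros) auto
    show "g t = e s + exp (L (s, t))" if "t \<in> {0..1}" for t by (rule gL[OF s that])
  qed
  have E: "L (1, t) - L (0, t) = 2 * of_real pi * \<i> * winding_number e (g t)" if t: "t \<in> {0..1}" for t
  proof -
    have "L (1, t) + \<i> * pi - (L (0, t) + \<i> * pi) = 2 * of_real pi * \<i> * winding_number e (g t)"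
    proof (rule continuous_log_increment[OF e, where h = "\<lambda>s. L (s, t) + \<i> * pi"])
      show "g t \<notin> path_image e" using ne t by (force simp: path_image_def)
      show "continuous_on {0..1} (\<lambda>s. L (s, t) + \<i> * pi)"
        using t by (intro continuous_on_add contL continuous_intros) auto
      show "e s = g t + exp (L (s, t) + \<i> * pi)" if "s \<in> {0..1}" for s by (rule eL[OF that t])
    qed
    then show ?thesis by simp
  qed
  have "2 * of_real pi * \<i> * (winding_number g (e 0) + winding_number e (g 1)) =
    2 * of_real pi * \<i> * (winding_number e (g 0) + winding_number g (e 1))"
    using G[of 0] G[of 1] E[of 0] E[of 1] by (simp add: algebra_simps)
  then have "winding_number g (e 0) + winding_number e (g 1) = winding_number e (g 0) + winding_number g (e 1)"
    by (subst (asm) mult_cancel_left) auto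
  then show ?thesis by (simp add: pathstart_def pathfinish_def)
qed

text \<open>The ends determine the winding number of an open path up to an integer; this integer is
  all that the parity argument keeps of the drawing.\<close>

lemma winding_number_eq_log_diff:
  assumes "path g" "a \<notin> path_image g"
    and "exp u = pathstart g - a" "exp v = pathfinish g - a"
  shows "\<exists>n::int. 2 * of_real pi * \<i> * winding_number g a = v - u + of_int (2 * n) * pi * \<i>"
proof -
  have "exp v = exp (2 * of_real pi * \<i> * winding_number g a) * exp u"
    using winding_number_exp_2pi[OF assms(1,2)] assms(3,4) by simp
  then have "exp (2 * of_real pi * \<i> * winding_number g a) = exp (v - u)"
    by (simp add: exp_diff field_simps)
  then show ?thesis unfolding exp_eq .
qed

text \<open>The relation for disjoint paths is applied to the 15 pairs of disjoint edges; after subtracting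
  a fixed choice of logarithms, the sum of these relations has twice an integer on the left and the
  number 5 of interleaving pairs on the right.\<close>

lemma K5_drawing_crosses:
  fixes x :: "nat \<Rightarrow> complex" and p :: "nat \<Rightarrow> nat \<Rightarrow> real \<Rightarrow> complex"
  assumes p: "\<And>i j. i < j \<Longrightarrow> j < 5 \<Longrightarrow> path (p i j) \<and> pathstart (p i j) = x i \<and> pathfinish (p i j) = x j"
    and disj: "\<And>i j k l. i < j \<Longrightarrow> j < 5 \<Longrightarrow> k < l \<Longrightarrow> l < 5 \<Longrightarrow> {i, j} \<inter> {k, l} = {} \<Longrightarrow>
      path_image (p i j) \<inter> path_image (p k l) = {}"
  shows False
proof -
  have mem: "x i \<in> path_image (p i j)" "x j \<in> path_image (p i j)" if "i < j" "j < 5" for i j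
    using p[OF that] pathstart_in_path_image[of "p i j"] pathfinish_in_path_image[of "p i j"] by auto
  \<comment> \<open>Among five vertices there is an \<open>m\<close> besides \<open>a\<close>,
    \<open>k\<close> and \<open>l\<close>, and the path between \<open>a\<close> and
    \<open>m\<close> avoids the one from \<open>k\<close> to \<open>l\<close>.\<close>
  have avoid: "x a \<notin> path_image (p k l)" if a: "a < 5" "a \<noteq> k" "a \<noteq> l" and kl: "k < l" "l < 5" for a k l
  proof -
    have "card {a, k, l} < card {..<5::nat}" by (simp add: card_insert_if)
    then have "\<not> {..<5::nat} \<subseteq> {a, k, l}" using card_mono[of "{a, k, l}" "{..<5}"] by auto
    then obtain m where m: "m < 5" "m \<noteq> a" "m \<noteq> k" "m \<noteq> l" by auto
    show ?thesis
    proof (cases "a < m")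
      case True
      have "path_image (p a m) \<inter> path_image (p k l) = {}" using a m kl True by (intro disj) auto
      then show ?thesis using mem[OF True m(1)] by blast
    next
      case False
      then have "m < a" using m by simp
      have "path_image (p m a) \<inter> path_image (p k l) = {}" using a m kl \<open>m < a\<close> by (intro disj) auto
      then show ?thesis using mem[OF \<open>m < a\<close> a(1)] by blast
    qed
  qed
  \<comment> \<open>One logarithm is chosen per unordered pair, so \<open>\<l> a b\<close> and
    \<open>\<l> b a\<close> differ by exactly \<open>\<i> * pi\<close>, up to the sign later
    recorded by \<open>s\<close>.\<close>
  define \<l> where "\<l> a b = (if a < b then Ln (x b - x a) else Ln (x a - x b) + \<i> * pi)" for a b
  have dist: "x a \<noteq> x b" if "a < 5" "b < 5" "a \<noteq> b" for a b
  proof -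
    have "card {a, b} < card {..<5::nat}" by (simp add: card_insert_if)
    then have "\<not> {..<5::nat} \<subseteq> {a, b}" using card_mono[of "{a, b}" "{..<5}"] by auto
    then obtain m where "m < 5" "m \<noteq> a" "m \<noteq> b" by auto
    then show ?thesis using avoid[of a b m] avoid[of a m b] mem[of b m] mem[of m b] that
      by (cases "b < m") auto
  qed
  have exp_l: "exp (\<l> a b) = x b - x a" if "a < 5" "b < 5" "a \<noteq> b" for a b
    using dist[OF that] by (simp add: \<l>_def exp_add)
  have swap: "\<l> b a = \<l> a b + \<i> * pi" if "a < b" for a b using that by (simp add: \<l>_def)
  have "\<exists>n::int. 2 * of_real pi * \<i> * winding_number (p k l) (x a) = \<l> a l - \<l> a k + of_int (2 * n) * pi * \<i>"
    if "a < 5" "a \<noteq> k" "a \<noteq> l" "k < l" "l < 5" for a k l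
    using p[of k l] that by (intro winding_number_eq_log_diff avoid) (auto simp: exp_l)
  then obtain n :: "nat \<Rightarrow> nat \<Rightarrow> nat \<Rightarrow> int" where
    n: "\<And>a k l. a < 5 \<Longrightarrow> a \<noteq> k \<Longrightarrow> a \<noteq> l \<Longrightarrow> k < l \<Longrightarrow> l < 5 \<Longrightarrow>
      2 * of_real pi * \<i> * winding_number (p k l) (x a) = \<l> a l - \<l> a k + of_int (2 * n a k l) * pi * \<i>"
    by metis
  define s :: "nat \<Rightarrow> nat \<Rightarrow> int" where "s a b = (if a < b then 1 else - 1)" for a b
  have l_s: "\<l> a b - \<l> b a = - of_int (s a b) * pi * \<i>" if "a \<noteq> b" for a b
    using that swap[of a b] swap[of b a] by (cases "a < b") (auto simp: s_def)
  have eq: "2 * (n k i j + n j k l - n i k l - n l i j) = s i k - s i l + s k j - s l j"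
    if "i < j" "j < 5" "k < l" "l < 5" "i \<noteq> k" "i \<noteq> l" "j \<noteq> k" "j \<noteq> l" for i j k l
  proof -
    have "winding_number (p k l) (x i) + winding_number (p i j) (x l) =
        winding_number (p i j) (x k) + winding_number (p k l) (x j)"
      using winding_number_disjoint_paths[of "p i j" "p k l"] p[of i j] p[of k l] disj[of i j k l] that by auto
    then have "2 * of_real pi * \<i> * winding_number (p k l) (x i) + 2 * of_real pi * \<i> * winding_number (p i j) (x l) =
        2 * of_real pi * \<i> * winding_number (p i j) (x k) + 2 * of_real pi * \<i> * winding_number (p k l) (x j)"
      by (metis distrib_left)
    moreover note n[of i k l] n[of l i j] n[of k i j] n[of j k l]
    ultimately have "(\<l> i l - \<l> i k + of_int (2 * n i k l) * pi * \<i>) + (\<l> l j - \<l> l i + of_int (2 * n l i j) * pi * \<i>) =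
        (\<l> k j - \<l> k i + of_int (2 * n k i j) * pi * \<i>) + (\<l> j l - \<l> j k + of_int (2 * n j k l) * pi * \<i>)"
      using that by auto
    then have "of_int (2 * (n k i j + n j k l - n i k l - n l i j)) * (pi * \<i>) =
        (\<l> i l - \<l> l i) - (\<l> i k - \<l> k i) + (\<l> l j - \<l> j l) - (\<l> k j - \<l> j k)"
      by (simp add: algebra_simps)
    also have "\<dots> = of_int (s i k - s i l + s k j - s l j) * (pi * \<i>)"
      using that by (simp add: l_s algebra_simps)
    finally have "(of_int (2 * (n k i j + n j k l - n i k l - n l i j)) :: complex) = of_int (s i k - s i l + s k j - s l j)"
      by (subst (asm) mult_cancel_right) auto
    then show ?thesis by (simp only: of_int_eq_iff)
  qed
  \<comment> \<open>Each of the five four-element sets has three pairings; the right side is 2 for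
    the interleaving one and 0 for the others. An integer \<open>n a k l\<close> enters two
    relations, one for each edge from \<open>a\<close> to a vertex other than \<open>k\<close> and
    \<open>l\<close>, with equal or opposite signs. After halving the relations and adding them up,
    all coefficients are therefore even.\<close>
  note eqs = eq[of 0 1 2 3] eq[of 0 1 2 4] eq[of 0 1 3 4] eq[of 0 2 1 3] eq[of 0 2 1 4] eq[of 0 2 3 4] eq[of 0 3 1 2] 
    eq[of 0 3 1 4] eq[of 0 3 2 4] eq[of 0 4 1 2] eq[of 0 4 1 3] eq[of 0 4 2 3] eq[of 1 2 3 4] eq[of 1 3 2 4] 
    eq[of 1 4 2 3]
  have "2 * (n 2 0 1 - n 0 2 3 - n 0 2 4 - n 4 0 1 - n 0 3 4 + n 1 0 2 + n 2 1 3 - n 0 1 3 + n 2 1 4 - n 0 1 4 - n 4 0 2 + n 2 3 4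
     + n 1 0 3 + n 3 1 2 - n 0 1 2 - n 4 0 3 + n 3 2 4 + n 1 0 4 - n 3 0 4 + n 4 2 3) = (5::int)"
    using eqs by (simp add: s_def)
  then show False by presburger
qed

section \<open>From branch sets to paths in the drawing\<close>

lemma connected_in_Un:
  assumes sym: "sym E" and S: "connected_in E S" and T: "connected_in E T"
    and e: "x \<in> S" "y \<in> T" "(x, y) \<in> E"
  shows "connected_in E (S \<union> T)"
proof (rule connected_inI_root[OF sym])
  show "x \<in> S \<union> T" using e by blast
  fix z assume "z \<in> S \<union> T"
  then show "(x, z) \<in> (Restr E (S \<union> T))\<^sup>*"
  proof
    assume "z \<in> S"
    then have "(x, z) \<in> (Restr E S)\<^sup>*" using S e by (auto simp: connected_in_def)
    then show ?thesis by (rule Restr_rtrancl_mono) blast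
  next
    assume "z \<in> T"
    then have "(y, z) \<in> (Restr E T)\<^sup>*" using T e by (auto simp: connected_in_def)
    then have "(y, z) \<in> (Restr E (S \<union> T))\<^sup>*" by (rule Restr_rtrancl_mono) blast
    moreover have "(x, y) \<in> Restr E (S \<union> T)" using e by blast
    ultimately show ?thesis by (rule converse_rtrancl_into_rtrancl[rotated])
  qed
qed

definition drawing :: "'a pair_pre_digraph \<Rightarrow> ('a \<Rightarrow> complex) \<Rightarrow> ('a set \<Rightarrow> real \<Rightarrow> complex) \<Rightarrow> 'a set \<Rightarrow> complex set" where
  "drawing G p \<gamma> S = p ` S \<union> (\<Union>e\<in>{e \<in> edges G. e \<subseteq> S}. path_image (\<gamma> e))"

text \<open>\<open>drawing\<close> takes only edges with both ends inside the set. Edges of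
  \<open>S\<close> and of \<open>T\<close> have no common end and so do not meet, and an edge meets
  vertex positions only at its own ends.\<close>

lemma drawing_disjoint:
  assumes emb: "plane_embedding G p \<gamma>" and ST: "S \<subseteq> pverts G" "T \<subseteq> pverts G" "S \<inter> T = {}"
  shows "drawing G p \<gamma> S \<inter> drawing G p \<gamma> T = {}"
proof -
  have inj: "inj_on p (pverts G)"
    and vert: "\<And>e. e \<in> edges G \<Longrightarrow> path_image (\<gamma> e) \<inter> p ` pverts G = p ` e"
    and edge: "\<And>e f. e \<in> edges G \<Longrightarrow> f \<in> edges G \<Longrightarrow> e \<noteq> f \<Longrightarrow> path_image (\<gamma> e) \<inter> path_image (\<gamma> f) = p ` (e \<inter> f)"
    using emb unfolding plane_embedding_def by blast+
  have ne: "e \<noteq> {}" if "e \<in> edges G" for e using that by (auto simp: edges_def)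
  have pST: "p ` A \<inter> p ` B = {}" if "A \<subseteq> pverts G" "B \<subseteq> pverts G" "A \<inter> B = {}" for A B
    using inj_on_image_Int[OF inj that(1,2)] that(3) by simp
  have pe: "p ` A \<inter> path_image (\<gamma> e) = {}"
    if "A \<subseteq> pverts G" "B \<subseteq> pverts G" "A \<inter> B = {}" "e \<in> edges G" "e \<subseteq> B" for A B e
  proof -
    have "p ` A \<inter> p ` e = {}" by (rule pST) (use that in auto)
    moreover have "p ` A \<subseteq> p ` pverts G" using that(1) by (rule image_mono)
    ultimately have "z \<notin> path_image (\<gamma> e)" if "z \<in> p ` A" for z
      using vert[OF \<open>e \<in> edges G\<close>] that by (metis IntI empty_iff subsetD)
    then show ?thesis by (simp add: disjoint_iff)
  qed
  have ee: "path_image (\<gamma> e) \<inter> path_image (\<gamma> f) = {}"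
    if "e \<in> edges G" "f \<in> edges G" "e \<subseteq> S" "f \<subseteq> T" for e f
  proof -
    have "e \<inter> f = {}" using that ST by blast
    moreover then have "e \<noteq> f" using ne that by auto
    ultimately show ?thesis using edge that by simp
  qed
  have TS: "T \<inter> S = {}" using ST by blast
  have cases: "z \<in> p ` A \<or> (\<exists>e\<in>edges G. e \<subseteq> A \<and> z \<in> path_image (\<gamma> e))" if "z \<in> drawing G p \<gamma> A" for z A
    using that by (auto simp: drawing_def)
  have "z \<notin> drawing G p \<gamma> T" if z: "z \<in> drawing G p \<gamma> S" for z
  proof
    assume z': "z \<in> drawing G p \<gamma> T"
    show False
      using cases[OF z] cases[OF z']
    proof (elim disjE bexE conjE)
      assume "z \<in> p ` S" "z \<in> p ` T"
      then show False using pST[OF ST] by (metis IntI empty_iff)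
    next
      fix f assume "z \<in> p ` S" "f \<in> edges G" "f \<subseteq> T" "z \<in> path_image (\<gamma> f)"
      then show False using pe[OF ST, of f] by (metis IntI empty_iff)
    next
      fix e assume "z \<in> p ` T" "e \<in> edges G" "e \<subseteq> S" "z \<in> path_image (\<gamma> e)"
      then show False using pe[OF ST(2,1) TS, of e] by (metis IntI empty_iff)
    next
      fix e f assume "e \<in> edges G" "e \<subseteq> S" "z \<in> path_image (\<gamma> e)"
        "f \<in> edges G" "f \<subseteq> T" "z \<in> path_image (\<gamma> f)"
      then show False using ee[of e f] by (metis IntI empty_iff)
    qed
  qed
  then show ?thesis by (simp add: disjoint_iff)
qed

lemma drawing_path_component:
  assumes emb: "plane_embedding G p \<gamma>" and S: "connected_in (parcs G) S" and uv: "u \<in> S" "v \<in> S"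
  shows "path_component (drawing G p \<gamma> S) (p u) (p v)"
proof -
  have "(u, v) \<in> (Restr (parcs G) S)\<^sup>*" using S uv by (auto simp: connected_in_def)
  then show ?thesis
  proof (induction rule: rtrancl_induct)
    case base
    show ?case using uv by (auto simp: drawing_def intro!: path_component_refl)
  next
    case (step y z)
    let ?e = "{y, z}"
    have e: "?e \<in> edges G" "?e \<subseteq> S" using step by (auto simp: edges_def)
    have \<gamma>: "arc (\<gamma> ?e)" "{pathstart (\<gamma> ?e), pathfinish (\<gamma> ?e)} = p ` ?e"
      using emb e unfolding plane_embedding_def by blast+
    have "p y \<in> path_image (\<gamma> ?e)" "p z \<in> path_image (\<gamma> ?e)"
      using \<gamma>(2) pathstart_in_path_image[of "\<gamma> ?e"] pathfinish_in_path_image[of "\<gamma> ?e"]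
      by (auto simp: doubleton_eq_iff)
    moreover have "path_connected (path_image (\<gamma> ?e))" using \<gamma>(1) by (simp add: path_connected_path_image arc_imp_path)
    ultimately have "path_component (path_image (\<gamma> ?e)) (p y) (p z)"
      by (simp add: path_connected_component)
    moreover have "path_image (\<gamma> ?e) \<subseteq> drawing G p \<gamma> S" using e by (auto simp: drawing_def)
    ultimately have "path_component (drawing G p \<gamma> S) (p y) (p z)" by (rule path_component_of_subset[rotated])
    with step.IH show ?case by (rule path_component_trans)
  qed
qed

lemma pair_graph_sym: "pair_graph G \<Longrightarrow> sym (parcs G)"
proof -
  assume "pair_graph G"
  then interpret pair_graph G .
  show ?thesis using pair_sym_arcs by (auto simp: symmetric_def)
qed

text \<open>Representatives of the branch sets serve as vertices, and the edge between
  \<open>i\<close> and \<open>j\<close> is a path in the drawing of the connected set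
  \<open>b i \<union> b j\<close>. Two edges without a common end live in disjoint unions.\<close>

lemma planar_no_K5_minor:
  assumes "pair_graph G" "planar G"
  shows "\<not> clique_minor (parcs G) (pverts G) 5"
proof
  have sym: "sym (parcs G)" by (rule pair_graph_sym[OF assms(1)])
  obtain p \<gamma> where emb: "plane_embedding G p \<gamma>" using assms(2) by (auto simp: planar_def)
  assume "clique_minor (parcs G) (pverts G) 5"
  then obtain \<C> where \<C>: "card \<C> = 5" "minor_model (parcs G) (pverts G) \<C>" by (auto simp: clique_minor_def)
  then have "finite \<C>" by (simp add: minor_model_def)
  then obtain b where "bij_betw b {..<5::nat} \<C>"
    using ex_bij_betw_nat_finite[of \<C>] \<C>(1) by (auto simp: atLeast0LessThan)
  then have bC: "b i \<in> \<C>" and binj: "i \<noteq> j \<Longrightarrow> b i \<noteq> b j" if "i < 5" "j < 5" for i j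
    using that by (auto simp: bij_betw_def inj_on_def)
  have bV: "b i \<subseteq> pverts G" and bc: "connected_in (parcs G) (b i)" if "i < 5" for i
    using \<C>(2) bC[OF that that] unfolding minor_model_def by blast+
  have bd: "b i \<inter> b j = {}" and ba: "\<exists>x\<in>b i. \<exists>y\<in>b j. (x, y) \<in> parcs G" if "i < 5" "j < 5" "i \<noteq> j" for i j
    using \<C>(2) bC[OF that(1,1)] bC[OF that(2,2)] binj[OF that] unfolding minor_model_def by blast+
  have "\<exists>v. v \<in> b i" if "i < 5" for i using bc[OF that] by (auto simp: connected_in_def)
  then obtain v where v: "\<And>i. i < 5 \<Longrightarrow> v i \<in> b i" by metis
  have "\<exists>g. path g \<and> path_image g \<subseteq> drawing G p \<gamma> (b i \<union> b j) \<and> pathstart g = p (v i) \<and> pathfinish g = p (v j)"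
    if ij: "i < j" "j < 5" for i j
  proof -
    obtain x y where "x \<in> b i" "y \<in> b j" "(x, y) \<in> parcs G" using ba[of i j] ij by auto
    then have "connected_in (parcs G) (b i \<union> b j)"
      using ij by (intro connected_in_Un[OF sym bc bc]) auto
    then show ?thesis
      using drawing_path_component[OF emb, of "b i \<union> b j" "v i" "v j"] v ij
      by (auto simp: path_component_def)
  qed
  then obtain g where g: "\<And>i j. i < j \<Longrightarrow> j < 5 \<Longrightarrow> path (g i j) \<and>
      path_image (g i j) \<subseteq> drawing G p \<gamma> (b i \<union> b j) \<and> pathstart (g i j) = p (v i) \<and> pathfinish (g i j) = p (v j)"
    by metis
  show False
  proof (rule K5_drawing_crosses[of g "\<lambda>i. p (v i)"])
    fix i j assume "i < j" "j < (5::nat)"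
    then show "path (g i j) \<and> pathstart (g i j) = p (v i) \<and> pathfinish (g i j) = p (v j)" using g by blast
    fix k l assume kl: "k < l" "l < (5::nat)" "{i, j} \<inter> {k, l} = {}"
    have "(b i \<union> b j) \<inter> (b k \<union> b l) = {}"
      using bd[of i k] bd[of i l] bd[of j k] bd[of j l] \<open>i < j\<close> \<open>j < 5\<close> kl by auto
    then have "drawing G p \<gamma> (b i \<union> b j) \<inter> drawing G p \<gamma> (b k \<union> b l) = {}"
      using bV \<open>i < j\<close> \<open>j < 5\<close> kl by (intro drawing_disjoint[OF emb]) auto
    then show "path_image (g i j) \<inter> path_image (g k l) = {}"
      using g[of i j] g[of k l] \<open>i < j\<close> \<open>j < 5\<close> kl by blast
  qed
qed

section \<open>The spectral gap of the Glauber dynamics\<close>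

lemma sum_Pow_power_card:
  fixes x :: real
  assumes "finite A"
  shows "(\<Sum>B\<in>Pow A. x ^ card B) = (1 + x) ^ card A"
  using prod_add[OF assms, of "\<lambda>_. x" "\<lambda>_. 1"] by (simp add: add.commute)

locale hardcore_model = pair_graph G for G :: "'a pair_pre_digraph" +
  fixes lam :: real
  assumes lam_pos: "lam > 0" and verts_nonempty: "pverts G \<noteq> {}"
begin

abbreviation "V \<equiv> pverts G"
abbreviation "Ind \<equiv> independent_sets G"
abbreviation "Z \<equiv> partition_function G lam"
abbreviation "n \<equiv> card V"

text \<open>\<open>Z\<close> times the expectation under the hardcore distribution; without the
  normalisation, the identities below are between finite sums.\<close>

definition wsum :: "('a set \<Rightarrow> real) \<Rightarrow> real" where
  "wsum f = (\<Sum>I\<in>Ind. lam ^ card I * f I)"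

lemma pair_graph_G: "pair_graph G" by unfold_locales

lemma finite_Ind: "finite Ind"
  by (rule finite_independent_sets[OF pair_graph_G])

lemma Z_pos: "Z > 0"
  by (rule partition_function_pos[OF pair_graph_G lam_pos])

lemma n_pos: "n > 0"
  using verts_nonempty pair_finite_verts by (simp add: card_gt_0_iff)

lemma Ind_finite: "I \<in> Ind \<Longrightarrow> finite I"
  by (rule finite_subset[OF _ pair_finite_verts]) (simp add: independent_sets_def)

lemma Ind_subset: "I \<in> Ind \<Longrightarrow> J \<subseteq> I \<Longrightarrow> J \<in> Ind"
  unfolding independent_sets_def by blast

lemma wsum_one: "wsum (\<lambda>_. 1) = Z"
  by (simp add: wsum_def partition_function_def)

lemma wsum_mono: "(\<And>I. I \<in> Ind \<Longrightarrow> f I \<le> g I) \<Longrightarrow> wsum f \<le> wsum g"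
  unfolding wsum_def using lam_pos by (intro sum_mono mult_left_mono) auto

lemma wsum_nonneg: "(\<And>I. I \<in> Ind \<Longrightarrow> 0 \<le> f I) \<Longrightarrow> 0 \<le> wsum f"
  unfolding wsum_def using lam_pos by (intro sum_nonneg mult_nonneg_nonneg) auto

lemma wsum_sum: "wsum (\<lambda>I. \<Sum>v\<in>A. f v I) = (\<Sum>v\<in>A. wsum (f v))"
  unfolding wsum_def by (simp add: sum_distrib_left) (rule sum.swap)

lemma wsum_divide: "wsum (\<lambda>I. f I / c) = wsum f / c"
  unfolding wsum_def by (simp add: sum_divide_distrib)

lemma Z_le: "Z \<le> (1 + lam) ^ n"
proof -
  have "Z \<le> (\<Sum>I\<in>Pow V. lam ^ card I)"
    unfolding partition_function_def using pair_finite_verts lam_pos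
    by (intro sum_mono2) (auto simp: independent_sets_def)
  then show ?thesis by (simp add: sum_Pow_power_card[OF pair_finite_verts])
qed

section \<open>Resampling one vertex\<close>

lemma sum_Ind_split:
  fixes h :: "'a set \<Rightarrow> real"
  shows "(\<Sum>I\<in>Ind. h I) =
    (\<Sum>I\<in>{I \<in> Ind. v \<notin> I}. h I + (if insert v I \<in> Ind then h (insert v I) else 0))"
proof -
  have "{I \<in> Ind. v \<notin> I} \<union> {I \<in> Ind. v \<in> I} = Ind" by blast
  moreover have "sum h ({I \<in> Ind. v \<notin> I} \<union> {I \<in> Ind. v \<in> I}) =
      sum h {I \<in> Ind. v \<notin> I} + sum h {I \<in> Ind. v \<in> I}"
    by (rule sum.union_disjoint) (use finite_Ind in auto)
  ultimately have "sum h Ind = sum h {I \<in> Ind. v \<notin> I} + sum h {I \<in> Ind. v \<in> I}" by metis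
  also have "(\<Sum>I\<in>{I \<in> Ind. v \<in> I}. h I) = (\<Sum>I\<in>{I \<in> Ind. v \<notin> I \<and> insert v I \<in> Ind}. h (insert v I))"
    by (rule sum.reindex_bij_witness[where i = "\<lambda>I. insert v I" and j = "\<lambda>I. I - {v}"])
      (auto simp: insert_absorb intro: Ind_subset)
  also have "\<dots> = (\<Sum>I\<in>{I \<in> Ind. v \<notin> I}. if insert v I \<in> Ind then h (insert v I) else 0)"
  proof -
    have "{I \<in> Ind. v \<notin> I \<and> insert v I \<in> Ind} = {I \<in> {I \<in> Ind. v \<notin> I}. insert v I \<in> Ind}" by blast
    moreover have "finite {I \<in> Ind. v \<notin> I}" using finite_Ind by simp
    ultimately show ?thesis by (simp only: sum.inter_filter)
  qed
  finally show ?thesis by (simp add: sum.distrib)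
qed

lemma wsum_split:
  "wsum h = (\<Sum>I\<in>{I \<in> Ind. v \<notin> I}. lam ^ card I * (h I + (if insert v I \<in> Ind then lam * h (insert v I) else 0)))"
  unfolding wsum_def
  by (subst sum_Ind_split[of _ v], rule sum.cong) (auto simp: Ind_finite algebra_simps)

text \<open>The conditional expectation of \<open>f\<close> given the occupations off
  \<open>v\<close>. If \<open>v\<close> has an occupied neighbour, only the unoccupied state is
  possible.\<close>

definition resample :: "'a \<Rightarrow> ('a set \<Rightarrow> real) \<Rightarrow> 'a set \<Rightarrow> real" where
  "resample v f I = (if insert v I \<in> Ind then (f (I - {v}) + lam * f (insert v I)) / (1 + lam) else f (I - {v}))"

lemma wsum_resample: "wsum (resample v f) = wsum f"
  unfolding wsum_split[of _ v] using lam_pos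
  by (intro sum.cong) (auto simp: resample_def divide_simps, simp_all add: algebra_simps)

text \<open>Pythagoras for the projection \<open>resample v\<close>: what is lost is the conditional
  variance. For values \<open>a\<close> and \<open>b\<close> with weights 1 and \<open>lam\<close>
  this is \<open>lam * (b - a)^2 / (1 + lam)\<close>. The factor \<open>lam\<close> is the extra
  weight of the occupied configuration, the only one at which \<open>f I - f (I - {v})\<close> can
  be nonzero.\<close>

lemma wsum_resample_square:
  "wsum (\<lambda>I. (f I)\<^sup>2) - wsum (\<lambda>I. (resample v f I)\<^sup>2) = wsum (\<lambda>I. (f I - f (I - {v}))\<^sup>2) / (1 + lam)"
proof -
  have key: "a\<^sup>2 + lam * b\<^sup>2 - (1 + lam) * ((a + lam * b) / (1 + lam))\<^sup>2 = lam * (b - a)\<^sup>2 / (1 + lam)" for a b :: real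
    using lam_pos by (simp add: divide_simps power2_eq_square) (simp add: algebra_simps)
  have key': "lam ^ c * (a\<^sup>2 + lam * b\<^sup>2) - lam ^ c * (((a + lam * b) / (1 + lam))\<^sup>2 + lam * ((a + lam * b) / (1 + lam))\<^sup>2) =
      lam ^ c * (lam * (b - a)\<^sup>2) / (1 + lam)" for a b :: real and c
    using arg_cong[OF key[of a b], of "\<lambda>x. lam ^ c * x"] by (simp add: algebra_simps)
  show ?thesis
    unfolding wsum_split[of _ v] sum_subtractf[symmetric] sum_divide_distrib
    by (rule sum.cong) (auto simp: resample_def key')
qed

definition glauber_op :: "('a set \<Rightarrow> real) \<Rightarrow> 'a set \<Rightarrow> real" where
  "glauber_op f I = (\<Sum>v\<in>V. resample v f I) / n"

lemma cond_hardcore_ne: "I \<in> Ind \<Longrightarrow> set_pmf (hardcore G lam) \<inter> {J. J - {v} = I - {v}} \<noteq> {}"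
  by (rule hardcore_cond_ok[OF pair_graph_G lam_pos])

lemma set_cond_hardcore:
  "I \<in> Ind \<Longrightarrow> set_pmf (cond_pmf (hardcore G lam) {J. J - {v} = I - {v}}) = Ind \<inter> {J. J - {v} = I - {v}}"
  by (simp only: set_cond_pmf[OF cond_hardcore_ne] set_pmf_hardcore[OF pair_graph_G lam_pos])

lemma expectation_cond_hardcore:
  assumes I: "I \<in> Ind"
  shows "measure_pmf.expectation (cond_pmf (hardcore G lam) {J. J - {v} = I - {v}}) f = resample v f I"
proof -
  let ?S = "{J. J - {v} = I - {v}}" and ?I0 = "I - {v}" and ?I1 = "insert v I" and ?p = "hardcore G lam"
  have S: "?S = {?I0, ?I1}" by auto
  have I0: "?I0 \<in> Ind" using I by (rule Ind_subset) auto
  have p0: "pmf ?p ?I0 = lam ^ card ?I0 / Z" using I0 by (simp add: pmf_hardcore[OF pair_graph_G lam_pos])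
  have c1: "card ?I1 = Suc (card ?I0)" using Ind_finite[OF I] by (metis card.insert finite_Diff Diff_iff insertI1 insert_Diff_single)
  have p1: "pmf ?p ?I1 = (if ?I1 \<in> Ind then lam * pmf ?p ?I0 else 0)"
    unfolding p0 by (simp add: pmf_hardcore[OF pair_graph_G lam_pos] c1)
  have p0_pos: "pmf ?p ?I0 > 0" unfolding p0 using lam_pos Z_pos by simp
  have ne: "?I0 \<noteq> ?I1" by auto
  have prob: "measure_pmf.prob ?p ?S = pmf ?p ?I0 + pmf ?p ?I1"
    unfolding S using ne by (subst measure_measure_pmf_finite) auto
  have "measure_pmf.expectation (cond_pmf ?p ?S) f = (\<Sum>J\<in>{?I0, ?I1}. pmf (cond_pmf ?p ?S) J *\<^sub>R f J)"
    using set_cond_hardcore[OF I, of v] S by (intro integral_measure_pmf) auto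
  also have "\<dots> = pmf ?p ?I0 / measure_pmf.prob ?p ?S * f ?I0 + pmf ?p ?I1 / measure_pmf.prob ?p ?S * f ?I1"
    using ne by (simp add: pmf_cond[OF cond_hardcore_ne[OF I]])
  also have "\<dots> = resample v f I"
  proof -
    have "0 < pmf ?p ?I0 + lam * pmf ?p ?I0" using p0_pos lam_pos by (simp add: add_pos_pos)
    then show ?thesis
      unfolding prob p1 resample_def using p0_pos lam_pos
      by (auto simp: divide_simps) (auto simp: algebra_simps)
  qed
  finally show ?thesis .
qed

lemma set_glauber_step: "I \<in> Ind \<Longrightarrow> set_pmf (glauber_step G lam I) \<subseteq> Ind"
  by (auto simp: glauber_step_def set_cond_hardcore)

lemma expectation_glauber_step:
  assumes "I \<in> Ind"
  shows "measure_pmf.expectation (glauber_step G lam I) f = glauber_op f I"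
proof -
  have "measure_pmf.expectation (glauber_step G lam I) f =
      (\<Sum>v\<in>V. measure_pmf.expectation (cond_pmf (hardcore G lam) {J. J - {v} = I - {v}}) f /\<^sub>R n)"
    unfolding glauber_step_def using verts_nonempty pair_finite_verts finite_Ind assms
    by (intro pmf_expectation_bind_pmf_of_set) (auto simp: set_cond_hardcore)
  then show ?thesis
    by (simp add: expectation_cond_hardcore[OF assms] glauber_op_def sum_divide_distrib divide_inverse mult.commute sum_distrib_left)
qed

lemma set_glauber: "I \<in> Ind \<Longrightarrow> set_pmf (glauber G lam I t) \<subseteq> Ind"
  by (induction t) (use set_glauber_step in auto)

lemma expectation_glauber:
  assumes I: "I \<in> Ind"
  shows "measure_pmf.expectation (glauber G lam I t) f = (glauber_op ^^ t) f I"
\<comment> \<open>The last step of the chain acts first on the function, so \<open>f\<close> has to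
  vary.\<close>
proof (induction t arbitrary: f)
  case (Suc t)
  let ?p = "glauber G lam I t"
  have "measure_pmf.expectation (glauber G lam I (Suc t)) f =
      (\<Sum>J\<in>Ind. pmf ?p J *\<^sub>R measure_pmf.expectation (glauber_step G lam J) f)"
    using set_glauber[OF I, of t] finite_Ind finite_subset[OF set_glauber_step finite_Ind]
    unfolding glauber.simps by (intro pmf_expectation_bind) auto
  also have "\<dots> = (\<Sum>J\<in>Ind. pmf ?p J *\<^sub>R glauber_op f J)"
    by (intro sum.cong) (simp_all add: expectation_glauber_step)
  also have "\<dots> = measure_pmf.expectation ?p (glauber_op f)"
    using set_glauber[OF I, of t] finite_Ind by (intro integral_measure_pmf[symmetric]) auto
  also have "\<dots> = (glauber_op ^^ Suc t) f I"
    unfolding Suc.IH by (simp add: funpow_Suc_right del: funpow.simps)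
  finally show ?case .
qed simp

section \<open>Variance, Dirichlet form and canonical paths\<close>

definition wvar :: "('a set \<Rightarrow> real) \<Rightarrow> real" where
  "wvar f = wsum (\<lambda>I. (f I)\<^sup>2) - (wsum f)\<^sup>2 / Z"

text \<open>Each transition between \<open>I\<close> and \<open>I - {v}\<close> counts once, with
  the weight of \<open>I\<close>. The probability \<open>1 / (n * (1 + lam))\<close> of this removal
  is left out and reappears in the bound for \<open>glauber_op\<close>.\<close>

definition dirichlet :: "('a set \<Rightarrow> real) \<Rightarrow> real" where
  "dirichlet f = (\<Sum>v\<in>V. wsum (\<lambda>I. (f I - f (I - {v}))\<^sup>2))"

lemma wsum_glauber_op: "wsum (glauber_op f) = wsum f"
  using n_pos verts_nonempty by (simp add: glauber_op_def[abs_def] wsum_divide wsum_sum wsum_resample)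

text \<open>Being an average of the orthogonal projections \<open>resample v\<close>, the operator contracts the
  squared norm by at least the Dirichlet form.\<close>

lemma wvar_glauber_op: "wvar (glauber_op f) \<le> wvar f - dirichlet f / (n * (1 + lam))"
proof -
  have "(glauber_op f I)\<^sup>2 \<le> (\<Sum>v\<in>V. (resample v f I)\<^sup>2) / n" for I
    using sum_squared_le_sum_of_squares[of "\<lambda>v. resample v f I" V] n_pos
    by (simp add: glauber_op_def power_divide power2_eq_square divide_simps mult_ac)
  then have "wsum (\<lambda>I. (glauber_op f I)\<^sup>2) \<le> wsum (\<lambda>I. (\<Sum>v\<in>V. (resample v f I)\<^sup>2) / n)"
    by (intro wsum_mono)
  also have "\<dots> = (\<Sum>v\<in>V. wsum (\<lambda>I. (resample v f I)\<^sup>2)) / n"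
    by (simp add: wsum_divide wsum_sum)
  also have "(\<Sum>v\<in>V. wsum (\<lambda>I. (resample v f I)\<^sup>2)) =
      (\<Sum>v\<in>V. wsum (\<lambda>I. (f I)\<^sup>2) - wsum (\<lambda>I. (f I - f (I - {v}))\<^sup>2) / (1 + lam))"
    by (rule sum.cong) (simp_all add: wsum_resample_square[symmetric])
  also have "\<dots> = n * wsum (\<lambda>I. (f I)\<^sup>2) - dirichlet f / (1 + lam)"
    by (simp add: sum_subtractf dirichlet_def sum_divide_distrib)
  also have "\<dots> / n = wsum (\<lambda>I. (f I)\<^sup>2) - dirichlet f / (n * (1 + lam))"
    using n_pos verts_nonempty by (simp add: diff_divide_distrib mult.commute)
  finally show ?thesis by (simp add: wvar_def wsum_glauber_op)
qed

text \<open>The pair \<open>(I, J)\<close> is recovered from the intermediate configuration, its mirror image, and the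
  traces of \<open>I\<close> and \<open>J\<close> on \<open>D - A\<close>; only these traces are paid for.\<close>

lemma intermediate_wsum_le:
  assumes st: "sweep_state (parcs G) V w D A" and sym: "sym (parcs G)" and g: "\<And>I. g I \<ge> 0"
  shows "(\<Sum>(I, J)\<in>Ind \<times> Ind. lam ^ card I * lam ^ card J * g ((I - D) \<union> (J \<inter> A)))
    \<le> Z * (1 + lam) powr (2 * w) * wsum g"
proof -
  have AD: "A \<subseteq> D" "D \<subseteq> V" and no: "\<And>u v. u \<in> A \<Longrightarrow> v \<in> V - D \<Longrightarrow> (u, v) \<notin> parcs G" and w: "card (D - A) \<le> w"
    using st by (auto simp: sweep_state_def)
  have no': "(v, u) \<notin> parcs G" if "u \<in> A" "v \<in> V - D" for u v
    using no[OF that] symD[OF sym] by blast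
  define mix where "mix I J = (I - D) \<union> (J \<inter> A)" for I J :: "'a set"
  define L where "L = D - A"
  \<comment> \<open>Vertices of \<open>A\<close> have no neighbour outside \<open>D\<close>, so
    joining \<open>I - D\<close> and \<open>J \<inter> A\<close> creates no edge.\<close>
  have mix: "mix I J \<in> Ind" if "I \<in> Ind" "J \<in> Ind" for I J
    using that no no' unfolding mix_def independent_sets_def by blast
  define \<phi> where "\<phi> = (\<lambda>(I, J). ((mix I J, mix J I), (I \<inter> L, J \<inter> L)))"
  define h where "h = (\<lambda>((S :: 'a set, S' :: 'a set), (a :: 'a set, b :: 'a set)). lam ^ card S * g S * (lam ^ card S') * (lam ^ card a * lam ^ card b))"
  let ?T = "(Ind \<times> Ind) \<times> (Pow L \<times> Pow L)"
  have finL: "finite L" using AD pair_finite_verts finite_subset unfolding L_def by blast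
  have inj: "inj_on \<phi> (Ind \<times> Ind)"
  proof (rule inj_onI, clarify)
    fix I J I' J' assume "\<phi> (I, J) = \<phi> (I', J')"
    then have e: "mix I J = mix I' J'" "mix J I = mix J' I'" "I \<inter> L = I' \<inter> L" "J \<inter> L = J' \<inter> L"
      by (auto simp: \<phi>_def)
    have rec: "I = (mix I J - D) \<union> (I \<inter> L) \<union> (mix J I \<inter> A)" for I J
      using AD by (auto simp: mix_def L_def)
    show "I = I' \<and> J = J'" using rec[of I J] rec[of I' J'] rec[of J I] rec[of J' I'] e by metis
  qed
  have split: "card I + card J = card (mix I J) + card (mix J I) + (card (I \<inter> L) + card (J \<inter> L))"
    if "I \<in> Ind" "J \<in> Ind" for I J
  proof -
    have fin: "finite I" "finite J" using that Ind_finite by auto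
    have 1: "card I = card (I - D) + card (I \<inter> A) + card (I \<inter> L)" if "finite I" for I
    proof -
      have "I = ((I - D) \<union> (I \<inter> A)) \<union> (I \<inter> L)" using AD by (auto simp: L_def)
      then have "card I = card (((I - D) \<union> (I \<inter> A)) \<union> (I \<inter> L))" by simp
      also have "\<dots> = card ((I - D) \<union> (I \<inter> A)) + card (I \<inter> L)"
        using that AD by (intro card_Un_disjoint) (auto simp: L_def)
      also have "card ((I - D) \<union> (I \<inter> A)) = card (I - D) + card (I \<inter> A)"
        using that AD by (intro card_Un_disjoint) auto
      finally show ?thesis .
    qed
    have 2: "card (mix I J) = card (I - D) + card (J \<inter> A)" if "finite I" "finite J" for I J
      unfolding mix_def using that AD by (intro card_Un_disjoint) auto
    show ?thesis using 1[OF fin(1)] 1[OF fin(2)] 2[OF fin] 2[OF fin(2,1)] by simp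
  qed
  have "(\<Sum>(I, J)\<in>Ind \<times> Ind. lam ^ card I * lam ^ card J * g ((I - D) \<union> (J \<inter> A))) = (\<Sum>x\<in>Ind \<times> Ind. h (\<phi> x))"
  proof (rule sum.cong[OF refl], clarify)
    fix I J assume IJ: "I \<in> Ind" "J \<in> Ind"
    have "lam ^ card I * lam ^ card J = lam ^ card (mix I J) * lam ^ card (mix J I) * (lam ^ card (I \<inter> L) * lam ^ card (J \<inter> L))"
      using split[OF IJ] by (simp flip: power_add)
    then show "lam ^ card I * lam ^ card J * g ((I - D) \<union> (J \<inter> A)) = h (\<phi> (I, J))"
      by (simp add: h_def \<phi>_def mix_def mult_ac)
  qed
  also have "\<dots> = (\<Sum>y\<in>\<phi> ` (Ind \<times> Ind). h y)" using inj by (simp add: sum.reindex)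
  \<comment> \<open>Passing from the image of \<open>\<phi>\<close> to all quadruples makes the sum
    a product; the two sums over \<open>Pow L\<close> are the price
    \<open>(1 + lam) ^ (2 * card L)\<close>.\<close>
  also have "\<dots> \<le> (\<Sum>y\<in>?T. h y)"
    using finite_Ind finL mix lam_pos g by (intro sum_mono2) (auto simp: \<phi>_def h_def)
  also have "\<dots> = wsum g * Z * ((\<Sum>a\<in>Pow L. lam ^ card a) * (\<Sum>b\<in>Pow L. lam ^ card b))"
    unfolding wsum_def partition_function_def sum_product sum.cartesian_product h_def
    by (rule sum.cong) auto
  also have "\<dots> = Z * wsum g * (1 + lam) ^ (2 * card L)"
    by (simp add: sum_Pow_power_card[OF finL] mult_2 power_add)
  also have "\<dots> \<le> Z * wsum g * (1 + lam) powr (2 * w)"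
  proof (rule mult_left_mono)
    have "(1 + lam) ^ (2 * card L) = (1 + lam) powr real (2 * card L)"
      using lam_pos by (intro powr_realpow[symmetric]) simp
    also have "\<dots> \<le> (1 + lam) powr (2 * w)"
      using w lam_pos unfolding L_def by (intro powr_mono) auto
    finally show "(1 + lam) ^ (2 * card L) \<le> (1 + lam) powr (2 * w)" .
    show "0 \<le> Z * wsum g" using Z_pos wsum_nonneg[of g] g by simp
  qed
  finally show ?thesis by (simp add: mult_ac)
qed

text \<open>\<open>2 * Z * wvar f\<close> is the weighted sum of \<open>(f I - f J)^2\<close> over
  all pairs. Along a path of \<open>2 * n\<close> steps Cauchy-Schwarz costs a factor
  \<open>2 * n\<close>, and summing the bound for a single step costs another; dividing by 2 leaves
  \<open>2 * n^2\<close>.\<close>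

lemma poincare:
  assumes sw: "(({}, {}), (V, V)) \<in> (sweep_step (parcs G) V w)\<^sup>*" and sym: "sym (parcs G)"
  shows "wvar f \<le> 2 * real n ^ 2 * (1 + lam) powr (2 * w) * dirichlet f"
proof -
  let ?m = "2 * n" and ?B = "Z * (1 + lam) powr (2 * w) * dirichlet f"
  obtain D A where DA: "D 0 = {}" "A 0 = {}" "D ?m = V" "A ?m = V"
    and step: "\<And>t. t < ?m \<Longrightarrow> ((D t, A t), (D (Suc t), A (Suc t))) \<in> sweep_step (parcs G) V w"
    using sweep_sequence[OF pair_finite_verts sw] by blast
  define S where "S t I J = (I - D t) \<union> (J \<inter> A t)" for t and I J :: "'a set"
  define W where "W I J = lam ^ card I * lam ^ card J" for I J :: "'a set"
  have W_nonneg: "W I J \<ge> 0" for I J using lam_pos by (simp add: W_def)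
  have diff_le: "(\<Sum>(I, J)\<in>Ind \<times> Ind. W I J * (f (S t I J) - f (S (Suc t) I J))\<^sup>2) \<le> ?B" if t: "t < ?m" for t
  proof -
    obtain v where v: "v \<notin> D t \<and> D (Suc t) = insert v (D t) \<and> A (Suc t) = A t \<or>
        v \<in> D t - A t \<and> D (Suc t) = D t \<and> A (Suc t) = insert v (A t)"
      and adm: "sweep_state (parcs G) V w (D t) (A t)" "sweep_state (parcs G) V w (D (Suc t)) (A (Suc t))"
      using step[OF t] by (auto simp: sweep_step_def)
    let ?g = "\<lambda>I. (f I - f (I - {v}))\<^sup>2"
    have vV: "v \<in> V" using v adm by (auto simp: sweep_state_def)
    have AD: "A t \<subseteq> D t" using adm by (auto simp: sweep_state_def)
    \<comment> \<open>\<open>q\<close> is the end of the step at which \<open>v\<close> may be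
      occupied: the start of a deletion, the end of a re-addition. The other end carries the same
      configuration without \<open>v\<close>.\<close>
    obtain q where q: "sweep_state (parcs G) V w (D q) (A q)"
      "\<And>I J. (f (S t I J) - f (S (Suc t) I J))\<^sup>2 = ?g (S q I J)"
    proof (cases "v \<in> D t")
      case False
      then have "S (Suc t) I J = S t I J - {v}" for I J using v AD by (auto simp: S_def)
      then show ?thesis using that[of t] adm by simp
    next
      case True
      then have "S t I J = S (Suc t) I J - {v}" for I J using v by (auto simp: S_def)
      then show ?thesis using that[of "Suc t"] adm by (simp add: power2_commute)
    qed
    have "(\<Sum>(I, J)\<in>Ind \<times> Ind. W I J * (f (S t I J) - f (S (Suc t) I J))\<^sup>2) =
        (\<Sum>(I, J)\<in>Ind \<times> Ind. lam ^ card I * lam ^ card J * ?g ((I - D q) \<union> (J \<inter> A q)))"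
      unfolding q(2) by (simp add: W_def S_def)
    also have "\<dots> \<le> Z * (1 + lam) powr (2 * w) * wsum ?g"
      by (rule intermediate_wsum_le[OF q(1) sym]) simp
    also have "\<dots> \<le> ?B"
    proof (rule mult_left_mono)
      show "wsum ?g \<le> dirichlet f" unfolding dirichlet_def
        using vV pair_finite_verts by (intro member_le_sum wsum_nonneg) auto
    qed (use Z_pos in simp)
    finally show ?thesis .
  qed
  have path: "(f I - f J)\<^sup>2 \<le> ?m * (\<Sum>t<?m. (f (S t I J) - f (S (Suc t) I J))\<^sup>2)" if "I \<in> Ind" "J \<in> Ind" for I J
  proof -
    have "S 0 I J = I" "S ?m I J = J" using that DA by (auto simp: S_def independent_sets_def)
    then have "f I - f J = (\<Sum>t<?m. f (S t I J) - f (S (Suc t) I J))"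
      using sum_lessThan_telescope'[of "\<lambda>t. f (S t I J)" ?m] by simp
    then show ?thesis using sum_squared_le_sum_of_squares[of "\<lambda>t. f (S t I J) - f (S (Suc t) I J)" "{..<?m}"]
      by (simp add: mult.commute)
  qed
  have ZZ: "(\<Sum>I\<in>Ind. lam ^ card I) = Z" by (simp add: partition_function_def)
  have "(\<Sum>(I, J)\<in>Ind \<times> Ind. W I J * (f I - f J)\<^sup>2) =
      (\<Sum>(I, J)\<in>Ind \<times> Ind. (lam ^ card I * (f I)\<^sup>2) * lam ^ card J + lam ^ card I * (lam ^ card J * (f J)\<^sup>2)
        - 2 * ((lam ^ card I * f I) * (lam ^ card J * f J)))"
    by (rule sum.cong) (auto simp: W_def power2_eq_square algebra_simps)
  also have "\<dots> = wsum (\<lambda>I. (f I)\<^sup>2) * Z + Z * wsum (\<lambda>I. (f I)\<^sup>2) - 2 * (wsum f * wsum f)"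
    unfolding wsum_def ZZ[symmetric] sum_product sum.cartesian_product
    by (simp add: sum.distrib sum_subtractf sum_distrib_left case_prod_unfold)
  also have "\<dots> = 2 * Z * wvar f"
    using Z_pos by (simp add: wvar_def power2_eq_square right_diff_distrib)
  finally have "2 * Z * wvar f = (\<Sum>(I, J)\<in>Ind \<times> Ind. W I J * (f I - f J)\<^sup>2)" ..
  also have "\<dots> \<le> (\<Sum>(I, J)\<in>Ind \<times> Ind. W I J * (?m * (\<Sum>t<?m. (f (S t I J) - f (S (Suc t) I J))\<^sup>2)))"
    using path W_nonneg by (intro sum_mono) (auto intro!: mult_left_mono)
  also have "\<dots> = ?m * (\<Sum>t<?m. \<Sum>(I, J)\<in>Ind \<times> Ind. W I J * (f (S t I J) - f (S (Suc t) I J))\<^sup>2)"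
    by (subst sum.swap) (simp add: sum_distrib_left case_prod_unfold mult_ac)
  also have "\<dots> \<le> ?m * (\<Sum>t<?m. ?B)"
    using diff_le by (intro mult_left_mono sum_mono) auto
  also have "\<dots> = 2 * Z * (2 * real n ^ 2 * (1 + lam) powr (2 * w) * dirichlet f)"
    by (simp add: power2_eq_square)
  finally show ?thesis using Z_pos by (simp add: mult_ac)
qed

section \<open>From variance decay to the mixing time\<close>

text \<open>The constant of \<open>poincare\<close> times the factor \<open>n * (1 + lam)\<close> of
  \<open>wvar_glauber_op\<close>: each step removes at least the fraction \<open>1 / relax w\<close>
  of the variance.\<close>

definition relax :: "real \<Rightarrow> real" where
  "relax w = 2 * real n ^ 3 * (1 + lam) powr (2 * w + 1)"

lemma relax_ge_1:
  assumes "w \<ge> 0"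
  shows "1 \<le> relax w"
proof -
  have "1 \<le> (1 + lam) powr (2 * w + 1)" using lam_pos assms by (intro ge_one_powr_ge_zero) auto
  moreover have "1 \<le> real n ^ 3" using n_pos by (intro one_le_power) simp
  ultimately have "1 * 1 \<le> real n ^ 3 * (1 + lam) powr (2 * w + 1)" by (intro mult_mono) auto
  then show ?thesis unfolding relax_def by simp
qed

lemma wvar_contraction:
  assumes sw: "(({}, {}), (V, V)) \<in> (sweep_step (parcs G) V w)\<^sup>*" and sym: "sym (parcs G)"
  shows "wvar (glauber_op f) \<le> (1 - 1 / relax w) * wvar f"
proof -
  let ?B = "(1 + lam) powr (2 * w)"
  have pos: "0 < ?B" "0 < 1 + lam" "0 < real n" using lam_pos n_pos by auto
  have r: "relax w = (2 * real n ^ 2 * ?B) * (n * (1 + lam))"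
    using lam_pos by (simp add: relax_def powr_add power3_eq_cube power2_eq_square)
  have "wvar f / relax w \<le> (2 * real n ^ 2 * ?B * dirichlet f) / relax w"
    using poincare[OF sw sym, of f] pos unfolding r by (intro divide_right_mono) auto
  also have "\<dots> = dirichlet f / (n * (1 + lam))"
    unfolding r using pos by (simp add: divide_simps)
  finally show ?thesis using wvar_glauber_op[of f] by (simp add: left_diff_distrib)
qed

lemma wvar_funpow:
  assumes sw: "(({}, {}), (V, V)) \<in> (sweep_step (parcs G) V w)\<^sup>*" and sym: "sym (parcs G)" and w: "w \<ge> 0"
  shows "wvar ((glauber_op ^^ t) f) \<le> (1 - 1 / relax w) ^ t * wvar f"
proof (induction t)
  case (Suc t)
  have "wvar ((glauber_op ^^ Suc t) f) \<le> (1 - 1 / relax w) * wvar ((glauber_op ^^ t) f)"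
    using wvar_contraction[OF sw sym] by simp
  also have "\<dots> \<le> (1 - 1 / relax w) * ((1 - 1 / relax w) ^ t * wvar f)"
    using relax_ge_1[OF w] by (intro mult_left_mono Suc.IH) (simp add: divide_simps)
  finally show ?case by (simp add: mult.assoc)
qed simp

lemma wsum_funpow: "wsum ((glauber_op ^^ t) f) = wsum f"
  by (induction t) (simp_all add: wsum_glauber_op)

text \<open>Keeping one term of the variance turns decay in mean square into a bound for a fixed
  starting set, at the price of its weight.\<close>

lemma wvar_ge_point:
  assumes "I \<in> Ind"
  shows "lam ^ card I * (f I - wsum f / Z)\<^sup>2 \<le> wvar f"
proof -
  let ?c = "wsum f / Z"
  have "lam ^ card I * (f I - ?c)\<^sup>2 \<le> wsum (\<lambda>I. (f I - ?c)\<^sup>2)"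
    unfolding wsum_def using assms finite_Ind lam_pos by (intro member_le_sum) auto
  also have "\<dots> = wsum (\<lambda>I. (f I)\<^sup>2) - 2 * ?c * wsum f + ?c\<^sup>2 * Z"
    unfolding wsum_def partition_function_def sum_distrib_left sum_subtractf[symmetric] sum.distrib[symmetric]
    by (rule sum.cong) (auto simp: power2_eq_square algebra_simps)
  also have "\<dots> = wvar f" using Z_pos by (simp add: wvar_def power2_eq_square)
  finally show ?thesis .
qed

lemma prob_hardcore: "measure_pmf.prob (hardcore G lam) A = wsum (indicator A) / Z"
proof -
  have "measure_pmf.prob (hardcore G lam) A = measure_pmf.expectation (hardcore G lam) (indicator A)" by simp
  also have "\<dots> = (\<Sum>I\<in>Ind. pmf (hardcore G lam) I *\<^sub>R indicator A I)"
    using finite_Ind by (intro integral_measure_pmf) (auto simp: set_pmf_hardcore[OF pair_graph_G lam_pos])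
  also have "\<dots> = wsum (indicator A) / Z"
    unfolding wsum_def sum_divide_distrib
    by (rule sum.cong) (auto simp: pmf_hardcore[OF pair_graph_G lam_pos])
  finally show ?thesis .
qed

text \<open>The iterated operator, applied to the indicator of an event and evaluated at
  \<open>I\<close>, is the probability of the event after \<open>t\<close> steps from
  \<open>I\<close>. The 16 is the square of the 4 in the distance.\<close>

lemma tv_dist_glauber_le:
  assumes sw: "(({}, {}), (V, V)) \<in> (sweep_step (parcs G) V w)\<^sup>*" and sym: "sym (parcs G)" and w: "w \<ge> 0"
    and I: "I \<in> Ind" and t: "(1 - 1 / relax w) ^ t * Z \<le> lam ^ card I / 16"
  shows "tv_dist (glauber G lam I t) (hardcore G lam) \<le> 1 / 4"
  unfolding tv_dist_def
proof (rule cSUP_least)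
  fix A :: "'a set set"
  let ?f = "indicator A :: 'a set \<Rightarrow> real" and ?q = "1 - 1 / relax w"
  let ?d = "measure_pmf.prob (glauber G lam I t) A - measure_pmf.prob (hardcore G lam) A"
  have "measure_pmf.prob (glauber G lam I t) A = (glauber_op ^^ t) ?f I"
    using expectation_glauber[OF I, of t ?f] by simp
  then have "lam ^ card I * ?d\<^sup>2 \<le> wvar ((glauber_op ^^ t) ?f)"
    using wvar_ge_point[OF I, of "(glauber_op ^^ t) ?f"] by (simp add: wsum_funpow prob_hardcore)
  also have "\<dots> \<le> ?q ^ t * wvar ?f" by (rule wvar_funpow[OF sw sym w])
  also have "\<dots> \<le> ?q ^ t * Z"
  proof (rule mult_left_mono)
    have "wsum (\<lambda>I. (?f I)\<^sup>2) \<le> wsum (\<lambda>_. 1)"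
      by (intro wsum_mono) (simp add: indicator_def)
    moreover have "0 \<le> (wsum ?f)\<^sup>2 / Z" using Z_pos by simp
    ultimately show "wvar ?f \<le> Z" unfolding wvar_def wsum_one by linarith
    show "0 \<le> ?q ^ t" using relax_ge_1[OF w] by (simp add: divide_simps)
  qed
  also have "\<dots> \<le> lam ^ card I * (1 / 4)\<^sup>2" using t by (simp add: power2_eq_square)
  finally have "?d\<^sup>2 \<le> (1 / 4)\<^sup>2" using lam_pos by simp
  then show "\<bar>?d\<bar> \<le> 1 / 4" using abs_le_square_iff[of ?d "1 / 4"] by simp
qed simp

text \<open>\<open>R\<close> bounds \<open>Z / lam ^ card I\<close> for every starting set, so about
  \<open>relax w * ln (16 * R)\<close> steps suffice. Bounding logarithms by their arguments costs
  only the factor \<open>n * (1 + lam) * (16 + 1 / b)\<close>. In 33, twice this 16 is increased by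
  1 for rounding \<open>t\<close> up.\<close>

lemma mixing_time_le:
  assumes sw: "(({}, {}), (V, V)) \<in> (sweep_step (parcs G) V w)\<^sup>*" and sym: "sym (parcs G)" and w: "w \<ge> 0"
    and b: "0 < b" "b \<le> 1" "b \<le> lam"
  shows "ereal_of_enat (mixing_time G lam) \<le> ereal (real n ^ 4 * (33 + 2 / b) * (1 + lam) powr (2 * w + 2))"
proof -
  define R where "R = ((1 + lam) / b) ^ n"
  have ratio: "1 \<le> (1 + lam) / b" using b by simp
  have R1: "1 \<le> R" unfolding R_def using ratio by (rule one_le_power)
  have lnR: "ln R \<le> n * ((1 + lam) / b)"
  proof -
    have "ln ((1 + lam) / b) \<le> (1 + lam) / b" using ratio ln_le_minus_one[of "(1 + lam) / b"] by linarith
    then have "n * ln ((1 + lam) / b) \<le> n * ((1 + lam) / b)" by (intro mult_left_mono) auto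
    then show ?thesis unfolding R_def using ratio by (subst ln_realpow) auto
  qed
  have ln16: "ln (16 * R) \<le> 16 + n * ((1 + lam) / b)"
    using lnR ln_le_minus_one[of "16::real"] R1 by (simp add: ln_mult)
  have ln_nonneg: "0 \<le> ln (16 * R)" using R1 by simp
  let ?r = "relax w"
  have r1: "1 \<le> ?r" by (rule relax_ge_1[OF w])
  define t where "t = nat \<lceil>?r * ln (16 * R)\<rceil>"
  have t_ge: "?r * ln (16 * R) \<le> t" unfolding t_def by linarith
  have t_le: "real t \<le> ?r * ln (16 * R) + 1"
    unfolding t_def using r1 ln_nonneg by (simp add: of_nat_ceiling)
  have "(1 - 1 / ?r) ^ t \<le> exp (- 1 / ?r) ^ t"
    using r1 exp_ge_add_one_self[of "- 1 / ?r"] by (intro power_mono) (auto simp: divide_simps)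
  also have "\<dots> = exp (- (t / ?r))" by (simp flip: exp_of_nat_mult)
  also have "\<dots> \<le> exp (- ln (16 * R))" using t_ge r1 by (simp add: divide_simps mult.commute)
  also have "\<dots> = 1 / (16 * R)" using R1 by (simp add: exp_minus divide_simps)
  finally have decay: "(1 - 1 / ?r) ^ t \<le> 1 / (16 * R)" .
  have "tv_dist (glauber G lam I t) (hardcore G lam) \<le> 1 / 4" if I: "I \<in> Ind" for I
  proof (rule tv_dist_glauber_le[OF sw sym w I])
    have "card I \<le> n" using I pair_finite_verts by (intro card_mono) (auto simp: independent_sets_def)
    then have "b ^ n \<le> b ^ card I" using b by (intro power_decreasing) auto
    also have "\<dots> \<le> lam ^ card I" using b by (intro power_mono) auto
    finally have bI: "b ^ n \<le> lam ^ card I" .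
    have "(1 - 1 / ?r) ^ t * Z \<le> 1 / (16 * R) * (1 + lam) ^ n"
      using decay Z_le Z_pos R1 by (intro mult_mono) auto
    also have "\<dots> = b ^ n / 16" using lam_pos b by (simp add: R_def power_divide)
    also have "\<dots> \<le> lam ^ card I / 16" using bI by simp
    finally show "(1 - 1 / ?r) ^ t * Z \<le> lam ^ card I / 16" .
  qed
  then have "mixing_time G lam \<le> enat t"
    unfolding mixing_time_def by (intro INF_lower) auto
  then have "ereal_of_enat (mixing_time G lam) \<le> ereal (real t)"
    using ereal_of_enat_le_iff[of "mixing_time G lam" "enat t"] by simp
  also have "real t \<le> real n ^ 4 * (33 + 2 / b) * (1 + lam) powr (2 * w + 2)"
  proof -
    let ?P = "(1 + lam) powr (2 * w + 1)"
    have n1: "1 \<le> real n" using n_pos by simp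
    have "16 * 1 \<le> 16 * (n * (1 + lam))"
      using n1 lam_pos mult_mono[of 1 "real n" 1 "1 + lam"] by simp
    then have "ln (16 * R) \<le> n * (1 + lam) * (16 + 1 / b)"
      using ln16 by (simp add: algebra_simps add_divide_distrib)
    then have "?r * ln (16 * R) \<le> ?r * (n * (1 + lam) * (16 + 1 / b))"
      using r1 by (intro mult_left_mono) auto
    also have "\<dots> = real n ^ 4 * (2 * (16 + 1 / b)) * (?P * (1 + lam))"
      by (simp only: relax_def power4_eq_xxxx power3_eq_cube mult_ac)
    also have "2 * (16 + 1 / b) = 32 + 2 / b" by simp
    also have "?P * (1 + lam) = (1 + lam) powr (2 * w + 2)"
      using lam_pos powr_add[of "1 + lam" "2 * w + 1" 1] by (simp add: add.assoc)
    finally have "real t \<le> real n ^ 4 * (32 + 2 / b) * (1 + lam) powr (2 * w + 2) + 1"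
      using t_le by linarith
    moreover have "1 * 1 \<le> real n ^ 4 * (1 + lam) powr (2 * w + 2)"
      using n1 lam_pos w by (intro mult_mono one_le_power ge_one_powr_ge_zero) auto
    ultimately show ?thesis by (simp add: algebra_simps)
  qed
  finally show ?thesis by simp
qed

end

section \<open>The mixing time on planar graphs\<close>

text \<open>Excluding five branch sets requires \<open>m^2 \<ge> 4 * card W\<close>, so
  \<open>m\<close> is \<open>2 * sqrt (card W)\<close> rounded up. Then
  \<open>5 * m \<le> 15 * sqrt (card W)\<close>, and the factor \<open>7 / 2\<close> of the
  recursion gives \<open>105 / 2\<close>.\<close>

lemma planar_sweep:
  assumes G: "pair_graph G" "planar G"
  shows "(({}, {}), (pverts G, pverts G)) \<in> (sweep_step (parcs G) (pverts G) (105 / 2 * sqrt (card (pverts G))))\<^sup>*"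
proof -
  interpret pair_graph G by fact
  have sym: "sym (parcs G)" by (rule pair_graph_sym[OF G(1)])
  have sep: "\<exists>X\<subseteq>W. real (card X) \<le> 15 * sqrt (card W) \<and>
      (\<forall>Q\<subseteq>W - X. connected_in (parcs G) Q \<longrightarrow> 2 * card Q \<le> card W)" if W: "W \<subseteq> pverts G" for W
  proof (cases "W = {}")
    case False
    have finW: "finite W" using W pair_finite_verts finite_subset by blast
    then have c1: "1 \<le> card W" using False by (simp add: Suc_leI card_gt_0_iff)
    then have s1: "1 \<le> sqrt (card W)" by simp
    define m where "m = nat \<lceil>2 * sqrt (card W)\<rceil>"
    have m: "2 * sqrt (card W) \<le> m" "m \<le> 2 * sqrt (card W) + 1" using s1 unfolding m_def by linarith+
    have "(2 * sqrt (card W))\<^sup>2 \<le> (real m)\<^sup>2" using m(1) by (intro power_mono) auto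
    then have "real ((5 - 1) * card W) \<le> real (m\<^sup>2)" by (simp add: power_mult_distrib)
    then have m2: "(5 - 1) * card W \<le> m\<^sup>2" by (simp only: of_nat_le_iff)
    have m0: "0 < m" using m(1) s1 by linarith
    have "\<not> clique_minor (parcs G) W 5" using planar_no_K5_minor[OF G] clique_minor_mono[OF _ W] by blast
    from clique_minor_free_separator[OF finW sym m0 m2 this] obtain X where
      X: "X \<subseteq> W" "card X \<le> 5 * m" "\<forall>Q\<subseteq>W - X. connected_in (parcs G) Q \<longrightarrow> 2 * card Q \<le> card W"
      by auto
    have "real (card X) \<le> real (5 * m)" using X(2) by (simp only: of_nat_le_iff)
    also have "\<dots> = 5 * real m" by simp
    also have "\<dots> \<le> 15 * sqrt (card W)" using m(2) s1 by linarith
    finally show ?thesis using X by blast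
  qed (auto simp: connected_in_def)
  show ?thesis using sweep_exists[OF pair_finite_verts sym, of 15] sep by simp
qed

theorem theorem4p4:
  shows "\<exists>C::real. \<forall>lam0>0. \<exists>f :: nat \<Rightarrow> real.
    (\<forall>\<^sub>F n in sequentially. f n \<le> C * sqrt (real n)) \<and>
    (\<forall>lam\<ge>lam0. \<forall>n\<ge>1. \<forall>G :: 'a pair_pre_digraph.
       pair_graph G \<longrightarrow> planar G \<longrightarrow> card (pverts G) = n \<longrightarrow>
       ereal_of_enat (mixing_time G lam) \<le> ereal ((1 + lam) powr f n))"
proof (intro exI[of _ "106 :: real"] allI impI)
  fix lam0 :: real assume lam0: "lam0 > 0"
  \<comment> \<open>\<open>b\<close> bounds every admissible \<open>lam\<close> from below, which
    makes \<open>K\<close> independent of \<open>lam\<close>.\<close>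
  define b where "b = min 1 lam0"
  have b: "0 < b" "b \<le> 1" "b \<le> lam0" using lam0 by (auto simp: b_def)
  define K where "K = 33 + 2 / b"
  have K: "1 \<le> K" using b by (simp add: K_def)
  define c where "c = ln (1 + lam0)"
  have c: "c > 0" using lam0 by (simp add: c_def)
  \<comment> \<open>105 is twice the width \<open>105 / 2\<close>, and the 2 comes from
    \<open>mixing_time_le\<close>. The last term rewrites \<open>n^4 * K\<close> as a power of
    \<open>1 + lam0\<close>; its exponent is nonnegative for \<open>n \<ge> 1\<close>, so
    \<open>1 + lam\<close> may replace the base. It grows logarithmically in \<open>n\<close>, hence
    106 in place of 105 suffices eventually.\<close>
  define f :: "nat \<Rightarrow> real" where "f n = 105 * sqrt n + 2 + ln (real n ^ 4 * K) / c" for n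
  show "\<exists>f :: nat \<Rightarrow> real.
    (\<forall>\<^sub>F n in sequentially. f n \<le> 106 * sqrt (real n)) \<and>
    (\<forall>lam\<ge>lam0. \<forall>n\<ge>1. \<forall>G :: 'a pair_pre_digraph.
       pair_graph G \<longrightarrow> planar G \<longrightarrow> card (pverts G) = n \<longrightarrow>
       ereal_of_enat (mixing_time G lam) \<le> ereal ((1 + lam) powr f n))"
  proof (intro exI[of _ f] conjI allI impI)
    have "0 < K" using K by simp
    then show "\<forall>\<^sub>F n in sequentially. f n \<le> 106 * sqrt (real n)"
      unfolding f_def using c by real_asymp
  next
    fix lam n and G :: "'a pair_pre_digraph"
    assume lam: "lam0 \<le> lam" and n: "1 \<le> n" and G: "pair_graph G" "planar G" and card: "card (pverts G) = n"
    have "hardcore_model G lam"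
      using G(1) lam lam0 n card by (auto simp: hardcore_model_def hardcore_model_axioms_def)
    then interpret hardcore_model G lam .
    let ?w = "105 / 2 * sqrt n"
    have X1: "1 \<le> real n ^ 4 * K"
      using n K mult_mono[of 1 "real n ^ 4" 1 K] by simp
    have "ln (real n ^ 4 * K) * c \<le> ln (real n ^ 4 * K) * ln (1 + lam)"
      using X1 lam lam0 unfolding c_def by (intro mult_left_mono) auto
    then have "ln (real n ^ 4 * K) \<le> ln (real n ^ 4 * K) / c * ln (1 + lam)"
      using c by (simp add: pos_le_divide_eq)
    then have "exp (ln (real n ^ 4 * K)) \<le> exp (ln (real n ^ 4 * K) / c * ln (1 + lam))" by simp
    then have X2: "real n ^ 4 * K \<le> (1 + lam) powr (ln (real n ^ 4 * K) / c)"
      using X1 lam lam0 by (simp add: powr_def)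
    have "ereal_of_enat (mixing_time G lam) \<le> ereal (real n ^ 4 * K * (1 + lam) powr (2 * ?w + 2))"
      using mixing_time_le[of ?w b] planar_sweep[OF G] pair_graph_sym[OF G(1)] b lam
      unfolding card K_def by simp
    also have "real n ^ 4 * K * (1 + lam) powr (2 * ?w + 2) \<le>
        (1 + lam) powr (ln (real n ^ 4 * K) / c) * (1 + lam) powr (2 * ?w + 2)"
      using X2 by (rule mult_right_mono) simp
    also have "\<dots> = (1 + lam) powr f n"
      by (simp add: f_def add_ac flip: powr_add)
    finally show "ereal_of_enat (mixing_time G lam) \<le> ereal ((1 + lam) powr f n)" by simp
  qed
qed

end
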